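(* Let $p>1$. In $\mathbf{P}^{\frac{3+p}{2}}(\mathbf{C})$ there exist no $3$-dimensional minimal CR submanifolds of maximal CR dimension with flat normal connection.
   Context: All manifolds are smooth and nonempty. $\mathbf{P}^{\frac{3+p}{2}}(\mathbf{C})$ is the complex projective space of complex dimension $\frac{3+p}{2}$ with the Fubini–Study metric of constant holomorphic sectional curvature $4$ and complex structure $J$. For a $3$-dimensional real submanifold $M^3$ (so of real codimension $p$) and $x\in M^3$, the holomorphic tangent space is $H_x(M^3)=JT_x(M^3)\cap T_x(M^3)$. $M^3$ is a CR submanifold of maximal CR dimension if $\dim_{\mathbf{R}}H_x(M^3)=2$ for every $x\in M^3$. The normal connection is flat if its curvature tensor $R^{\perp}$ vanishes. $M^3$ is minimal if its mean curvature vector vanishes identically. *)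

theory Defs
  imports "HOL-Analysis.Analysis"
begin

section \<open>Smooth maps and smooth manifolds\<close>

text \<open>Only meaningful for open sets \<open>S\<close>.\<close>

primrec times_differentiable_on ::
    "nat \<Rightarrow> 'a set \<Rightarrow> ('a::real_normed_vector \<Rightarrow> 'b::real_normed_vector) \<Rightarrow> bool" where
  "times_differentiable_on 0 S f \<longleftrightarrow> continuous_on S f"
| "times_differentiable_on (Suc k) S f \<longleftrightarrow>
     (\<forall>x\<in>S. f differentiable (at x)) \<and>
     (\<forall>v. times_differentiable_on k S (\<lambda>x. frechet_derivative f (at x) v))"

definition smooth_on :: "'a set \<Rightarrow> ('a::real_normed_vector \<Rightarrow> 'b::real_normed_vector) \<Rightarrow> bool" where
  "smooth_on S f \<longleftrightarrow> (\<forall>k. times_differentiable_on k S f)"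

text \<open>
  A chart is a pair of its domain and its coordinate map.  The dimension of the manifold is that
  of the type \<open>'e\<close>.  The atlas need not be maximal, and the manifold need not be connected.
\<close>

type_synonym ('m, 'e) chart = "'m set \<times> ('m \<Rightarrow> 'e)"

definition smooth_manifold :: "'m topology \<Rightarrow> ('m, 'e::euclidean_space) chart set \<Rightarrow> bool" where
  "smooth_manifold X A \<longleftrightarrow>
     Hausdorff_space X \<and> second_countable X \<and>
     (\<forall>(U, \<phi>)\<in>A. openin X U \<and> open (\<phi> ` U) \<and>
        homeomorphic_map (subtopology X U) (top_of_set (\<phi> ` U)) \<phi>) \<and>
     (\<Union>(U, \<phi>)\<in>A. U) = topspace X \<and>
     (\<forall>(U, \<phi>)\<in>A. \<forall>(V, \<psi>)\<in>A. smooth_on (\<phi> ` (U \<inter> V)) (\<psi> \<circ> inv_into U \<phi>))"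

text \<open>
  The coordinate expressions, with their domains, of a map \<open>F\<close> between manifolds with
  atlases \<open>A\<close> and \<open>B\<close>.
\<close>

definition coordinate_expressions ::
    "('m, 'e) chart set \<Rightarrow> ('q, 'f) chart set \<Rightarrow> ('m \<Rightarrow> 'q) \<Rightarrow> ('e set \<times> ('e \<Rightarrow> 'f)) set" where
  "coordinate_expressions A B F =
     {(\<phi> ` {x \<in> U. F x \<in> V}, \<psi> \<circ> F \<circ> inv_into U \<phi>) | U \<phi> V \<psi>. (U, \<phi>) \<in> A \<and> (V, \<psi>) \<in> B}"

text \<open>
  The openness of the preimages and the smoothness of the coordinate expressions together say
  that \<open>F\<close> is a smooth map for the topology which the atlas \<open>B\<close> induces on the target.
\<close>

definition smooth_immersion ::
    "'m topology \<Rightarrow> ('m, 'e::euclidean_space) chart set \<Rightarrow> ('q, 'f::euclidean_space) chart set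
      \<Rightarrow> ('m \<Rightarrow> 'q) \<Rightarrow> bool" where
  "smooth_immersion X A B F \<longleftrightarrow>
     F ` topspace X \<subseteq> (\<Union>(V, \<psi>)\<in>B. V) \<and>
     (\<forall>(V, \<psi>)\<in>B. openin X {x \<in> topspace X. F x \<in> V}) \<and>
     (\<forall>(W, f)\<in>coordinate_expressions A B F.
        smooth_on W f \<and> (\<forall>u\<in>W. inj (frechet_derivative f (at u))))"

section \<open>Riemannian geometry of an immersion in coordinates\<close>

text \<open>
  Here \<open>g q a b\<close> is a Riemannian metric at the point \<open>q\<close> of an open set of the coordinate
  space \<open>'f\<close>, and \<open>f\<close> is an immersion of an open set of the coordinate space of the
  submanifold.  The Christoffel map of the Levi-Civita connection is given by the Koszul
  formula for constant vector fields.
\<close>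

type_synonym 'f metric_field = "'f \<Rightarrow> 'f \<Rightarrow> 'f \<Rightarrow> real"

definition christoffel :: "'f::euclidean_space metric_field \<Rightarrow> 'f \<Rightarrow> 'f \<Rightarrow> 'f \<Rightarrow> 'f" where
  "christoffel g q a b = (THE c. \<forall>d. 2 * g q c d =
       frechet_derivative (\<lambda>r. g r b d) (at q) a
     + frechet_derivative (\<lambda>r. g r a d) (at q) b
     - frechet_derivative (\<lambda>r. g r a b) (at q) d)"

definition push_forward ::
    "('e::euclidean_space \<Rightarrow> 'f::euclidean_space) \<Rightarrow> ('e \<Rightarrow> 'e) \<Rightarrow> 'e \<Rightarrow> 'f" where
  "push_forward f X u = frechet_derivative f (at u) (X u)"

text \<open>The derivative \<open>\<nabla>\<^sub>X V\<close> of a field \<open>V\<close> of ambient vectors along \<open>f\<close>.\<close>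

definition covariant_derivative ::
    "'f::euclidean_space metric_field \<Rightarrow> ('e::euclidean_space \<Rightarrow> 'f) \<Rightarrow> ('e \<Rightarrow> 'e) \<Rightarrow> ('e \<Rightarrow> 'f) \<Rightarrow> 'e \<Rightarrow> 'f" where
  "covariant_derivative g f X V u =
     frechet_derivative V (at u) (X u) + christoffel g (f u) (push_forward f X u) (V u)"

definition tangent_space ::
    "('e::euclidean_space \<Rightarrow> 'f::euclidean_space) \<Rightarrow> 'e \<Rightarrow> 'f set" where
  "tangent_space f u = range (frechet_derivative f (at u))"

definition normal_space ::
    "'f::euclidean_space metric_field \<Rightarrow> ('e::euclidean_space \<Rightarrow> 'f) \<Rightarrow> 'e \<Rightarrow> 'f set" where
  "normal_space g f u = {v. \<forall>t\<in>tangent_space f u. g (f u) v t = 0}"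

definition normal_part ::
    "'f::euclidean_space metric_field \<Rightarrow> ('e::euclidean_space \<Rightarrow> 'f) \<Rightarrow> 'e \<Rightarrow> 'f \<Rightarrow> 'f" where
  "normal_part g f u v = (THE w. w \<in> normal_space g f u \<and> v - w \<in> tangent_space f u)"

definition second_fundamental_form ::
    "'f::euclidean_space metric_field \<Rightarrow> ('e::euclidean_space \<Rightarrow> 'f) \<Rightarrow> ('e \<Rightarrow> 'e) \<Rightarrow> ('e \<Rightarrow> 'e) \<Rightarrow> 'e \<Rightarrow> 'f" where
  "second_fundamental_form g f X Y u =
     normal_part g f u (covariant_derivative g f X (push_forward f Y) u)"

definition induced_metric ::
    "'f::euclidean_space metric_field \<Rightarrow> (real^'d \<Rightarrow> 'f) \<Rightarrow> real^'d \<Rightarrow> real^'d^'d" where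
  "induced_metric g f u = (\<chi> i j. g (f u)
     (push_forward f (\<lambda>_. axis i 1) u) (push_forward f (\<lambda>_. axis j 1) u))"

definition mean_curvature_vector ::
    "'f::euclidean_space metric_field \<Rightarrow> (real^'d \<Rightarrow> 'f) \<Rightarrow> real^'d \<Rightarrow> 'f" where
  "mean_curvature_vector g f u = (1 / real CARD('d)) *\<^sub>R
     (\<Sum>i\<in>UNIV. \<Sum>j\<in>UNIV. matrix_inv (induced_metric g f u) $ i $ j *\<^sub>R
        second_fundamental_form g f (\<lambda>_. axis i 1) (\<lambda>_. axis j 1) u)"

definition normal_connection ::
    "'f::euclidean_space metric_field \<Rightarrow> ('e::euclidean_space \<Rightarrow> 'f) \<Rightarrow> ('e \<Rightarrow> 'e) \<Rightarrow> ('e \<Rightarrow> 'f) \<Rightarrow> 'e \<Rightarrow> 'f" where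
  "normal_connection g f X \<nu> u = normal_part g f u (covariant_derivative g f X \<nu> u)"

definition lie_bracket :: "('e::euclidean_space \<Rightarrow> 'e) \<Rightarrow> ('e \<Rightarrow> 'e) \<Rightarrow> 'e \<Rightarrow> 'e" where
  "lie_bracket X Y u = frechet_derivative Y (at u) (X u) - frechet_derivative X (at u) (Y u)"

definition normal_curvature ::
    "'f::euclidean_space metric_field \<Rightarrow> ('e::euclidean_space \<Rightarrow> 'f) \<Rightarrow> ('e \<Rightarrow> 'e) \<Rightarrow> ('e \<Rightarrow> 'e)
      \<Rightarrow> ('e \<Rightarrow> 'f) \<Rightarrow> 'e \<Rightarrow> 'f" where
  "normal_curvature g f X Y \<nu> u =
     normal_connection g f X (normal_connection g f Y \<nu>) u
   - normal_connection g f Y (normal_connection g f X \<nu>) u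
   - normal_connection g f (lie_bracket X Y) \<nu> u"

section \<open>Complex projective space\<close>

definition complex_line :: "complex^'k \<Rightarrow> (complex^'k) set" where
  "complex_line z = range (\<lambda>c. c *s z)"

text \<open>
  Homogeneous coordinates are indexed by \<open>'n option\<close>, so that the complex projective space of
  complex dimension \<open>CARD('n)\<close> is the set of all lines \<open>complex_line z\<close> with \<open>z \<noteq> 0\<close>
  in \<open>complex^('n option)\<close>.  The standard affine chart with index \<open>i\<close> sets the homogeneous
  coordinate \<open>i\<close> to 1.  If \<open>i = Some k\<close>, the affine coordinate with index \<open>k\<close>,
  which is then free, takes the role of the homogeneous coordinate \<open>None\<close>.
\<close>

definition affine_lift :: "'n option \<Rightarrow> complex^'n \<Rightarrow> complex^('n option)" where
  "affine_lift i w = (\<chi> j. if j = i then 1 else case j of None \<Rightarrow> w $ the i | Some k \<Rightarrow> w $ k)"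

definition affine_point :: "'n option \<Rightarrow> complex^'n \<Rightarrow> (complex^('n option)) set" where
  "affine_point i w = complex_line (affine_lift i w)"

definition complex_projective_atlas ::
    "((complex^('n option)) set, complex^'n) chart set" where
  "complex_projective_atlas = (\<lambda>i. (range (affine_point i), inv (affine_point i))) ` UNIV"

lemma inj_affine_point: "inj (affine_point (i :: 'n::finite option))"
proof (rule injI)
  fix v w :: "complex^'n"
  assume eq: "affine_point i v = affine_point i w"
  have "affine_lift i v \<in> complex_line (affine_lift i v)"
    unfolding complex_line_def by (rule image_eqI[of _ _ 1]) simp_all
  then obtain c where c: "affine_lift i v = c *s affine_lift i w"
    using eq by (auto simp: affine_point_def complex_line_def)
  have "c = 1"
    using arg_cong[OF c, of "\<lambda>x. x $ i"] by (simp add: affine_lift_def)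
  then have l: "affine_lift i v $ j = affine_lift i w $ j" for j using c by simp
  have "v $ k = w $ k" for k
    using l[of "Some k"] l[of None] by (cases "i = Some k") (auto simp: affine_lift_def)
  then show "v = w" by (simp add: vec_eq_iff)
qed

lemma complex_projective_atlas_covers:
  "(\<Union>(V, \<psi>)\<in>complex_projective_atlas. V) = {complex_line z | z :: complex^('n::finite option). z \<noteq> 0}"
proof (intro equalityI subsetI)
  fix l :: "(complex^('n option)) set"
  assume "l \<in> (\<Union>(V, \<psi>)\<in>complex_projective_atlas. V)"
  then obtain i w where l: "l = complex_line (affine_lift i w)"
    by (auto simp: complex_projective_atlas_def affine_point_def)
  have "affine_lift i w $ i = 1" by (simp add: affine_lift_def)
  then have "affine_lift i w \<noteq> 0" by (metis zero_index zero_neq_one)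
  with l show "l \<in> {complex_line z | z. z \<noteq> 0}" by blast
next
  fix l :: "(complex^('n option)) set"
  assume "l \<in> {complex_line z | z. z \<noteq> 0}"
  then obtain z where l: "l = complex_line z" and "z \<noteq> 0" by blast
  then obtain i where i: "z $ i \<noteq> 0" by (auto simp: vec_eq_iff)
  define w where "w = (\<chi> k. z $ (if i = Some k then None else Some k) / z $ i)"
  have z: "z = z $ i *s affine_lift i w"
    using i by (auto simp: vec_eq_iff affine_lift_def w_def split: option.splits)
  have "c *s z = (c * z $ i) *s affine_lift i w" for c
    using arg_cong[OF z, of "\<lambda>x. c *s x"] by simp
  moreover have "c *s affine_lift i w = (c / z $ i) *s z" for c
    using i arg_cong[OF z, of "\<lambda>x. (c / z $ i) *s x"] by simp
  ultimately have "l = affine_point i w"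
    unfolding affine_point_def l complex_line_def by blast
  then show "l \<in> (\<Union>(V, \<psi>)\<in>complex_projective_atlas. V)"
    by (auto simp: complex_projective_atlas_def)
qed

definition hermitian :: "complex^'k \<Rightarrow> complex^'k \<Rightarrow> complex" where
  "hermitian a b = (\<Sum>k\<in>UNIV. a $ k * cnj (b $ k))"

text \<open>
  The Fubini-Study metric in affine coordinates.  The expression is the same in every standard
  affine chart.  The normalisation is the one with holomorphic sectional curvature 4: on the
  projective line the metric is \<open>\<bar>dw\<bar>\<^sup>2 / (1 + \<bar>w\<bar>\<^sup>2)\<^sup>2\<close>.
\<close>

definition fubini_study :: "(complex^'n) metric_field" where
  "fubini_study w a b =
     Re ((1 + hermitian w w) * hermitian a b - hermitian a w * hermitian w b)
       / (1 + (norm w)\<^sup>2)\<^sup>2"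

text \<open>
  Agreement with the usual expression in homogeneous coordinates.  The vector
  \<open>affine_lift i a - affine_lift i 0\<close> is the derivative of \<open>affine_lift i\<close> in direction \<open>a\<close>.
\<close>

lemma hermitian_self: "hermitian z z = complex_of_real ((norm z)\<^sup>2)"
  by (simp add: hermitian_def norm_vec_def L2_set_def sum_nonneg complex_norm_square[symmetric])

lemma fubini_study_homogeneous:
  fixes i :: "'n::finite option" and w a b :: "complex^'n"
  defines "z \<equiv> affine_lift i w"
    and "a' \<equiv> affine_lift i a - affine_lift i 0"
    and "b' \<equiv> affine_lift i b - affine_lift i 0"
  shows "fubini_study w a b =
    Re (hermitian z z * hermitian a' b' - hermitian a' z * hermitian z b') / (norm z) ^ 4"
proof -
  define h where "h j = (if j = i then None else if j = None then i else j)" for j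
  have "bij h" by (rule o_bij[of h]) (auto simp: h_def fun_eq_iff)
  then have "(\<Sum>j\<in>UNIV. F j) = (\<Sum>j\<in>UNIV. F (h j))" for F :: "'n option \<Rightarrow> complex"
    using sum.reindex_bij_betw[of h UNIV UNIV F] by simp
  then have sum: "(\<Sum>j\<in>UNIV. F j) = F i + (\<Sum>k\<in>UNIV. F (h (Some k)))" for F :: "'n option \<Rightarrow> complex"
    by (simp add: UNIV_option_conv sum.reindex h_def)
  have lift: "affine_lift i v $ i = 1" "affine_lift i v $ h (Some k) = v $ k" for v k
    by (auto simp: affine_lift_def h_def)
  have herm: "hermitian z z = 1 + hermitian w w" "hermitian a' b' = hermitian a b"
    "hermitian a' z = hermitian a w" "hermitian z b' = hermitian w b"
    unfolding hermitian_def z_def a'_def b'_def by (simp_all add: sum lift)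
  have "complex_of_real ((norm z)\<^sup>2) = complex_of_real (1 + (norm w)\<^sup>2)"
    using herm(1) by (simp add: hermitian_self)
  then have "(norm z)\<^sup>2 = 1 + (norm w)\<^sup>2" by (simp only: of_real_eq_iff)
  moreover have "(norm z) ^ 4 = ((norm z)\<^sup>2)\<^sup>2" by (simp flip: power_mult)
  ultimately have "(norm z) ^ 4 = (1 + (norm w)\<^sup>2)\<^sup>2" by simp
  then show ?thesis by (simp add: fubini_study_def herm)
qed

text \<open>The affine charts are holomorphic, so the complex structure \<open>J\<close> is multiplication by \<open>\<i>\<close>.\<close>

definition complex_structure :: "complex^'n \<Rightarrow> complex^'n" where
  "complex_structure v = \<i> *s v"

definition holomorphic_tangent_space ::
    "('e::euclidean_space \<Rightarrow> complex^'n) \<Rightarrow> 'e \<Rightarrow> (complex^'n) set" where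
  "holomorphic_tangent_space f u = complex_structure ` tangent_space f u \<inter> tangent_space f u"

section \<open>Three-dimensional submanifolds of complex projective space\<close>

text \<open>
  A submanifold is an immersed one: a manifold \<open>X\<close> with atlas \<open>A\<close> and an immersion \<open>F\<close>.
  The conditions below do not depend on charts; they are required in all pairs of charts.
\<close>

definition immersed_3_submanifold ::
    "'m topology \<Rightarrow> ('m, real^3) chart set \<Rightarrow> ('m \<Rightarrow> (complex^('n::finite option)) set) \<Rightarrow> bool" where
  "immersed_3_submanifold X A F \<longleftrightarrow>
     smooth_manifold X A \<and> topspace X \<noteq> {} \<and> smooth_immersion X A complex_projective_atlas F"

definition CR_submanifold_of_maximal_CR_dimension ::
    "('m, real^3) chart set \<Rightarrow> ('m \<Rightarrow> (complex^('n::finite option)) set) \<Rightarrow> bool" where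
  "CR_submanifold_of_maximal_CR_dimension A F \<longleftrightarrow>
     (\<forall>(W, f)\<in>coordinate_expressions A complex_projective_atlas F.
        \<forall>u\<in>W. dim (holomorphic_tangent_space f u) = 2)"

definition minimal_submanifold ::
    "('m, real^3) chart set \<Rightarrow> ('m \<Rightarrow> (complex^('n::finite option)) set) \<Rightarrow> bool" where
  "minimal_submanifold A F \<longleftrightarrow>
     (\<forall>(W, f)\<in>coordinate_expressions A complex_projective_atlas F.
        \<forall>u\<in>W. mean_curvature_vector fubini_study f u = 0)"

definition flat_normal_connection ::
    "('m, real^3) chart set \<Rightarrow> ('m \<Rightarrow> (complex^('n::finite option)) set) \<Rightarrow> bool" where
  "flat_normal_connection A F \<longleftrightarrow>
     (\<forall>(W, f)\<in>coordinate_expressions A complex_projective_atlas F.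
        \<forall>X Y \<nu>. smooth_on W X \<longrightarrow> smooth_on W Y \<longrightarrow> smooth_on W \<nu> \<longrightarrow>
          (\<forall>u\<in>W. \<nu> u \<in> normal_space fubini_study f u) \<longrightarrow>
          (\<forall>u\<in>W. normal_curvature fubini_study f X Y \<nu> u = 0))"

end

theory Submission
  imports Defs
begin

text \<open>
  Let \<open>x\<close> be a nonzero holomorphic tangent vector and \<open>\<nu>\<close> a nonzero normal vector such that \<open>J\<nu>\<close> is
  normal as well; such \<open>\<nu>\<close> exist for \<open>p > 1\<close>, since the tangent space and its image under \<open>J\<close> span
  only four real dimensions.  As \<open>J\<close> is parallel, the shape operator \<open>A\<close> of \<open>\<nu>\<close> determines that of
  \<open>J\<nu>\<close> on holomorphic tangent vectors, and the Ricci equation becomes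
  \<open>\<langle>R\<^sup>\<bottom>(x, Jx)\<nu>, J\<nu>\<rangle> = -2 |x|\<^sup>2 |\<nu>|\<^sup>2 - |A x|\<^sup>2 - |A (J x)|\<^sup>2 < 0\<close>.
\<close>

section \<open>Calculus of smooth functions\<close>

text \<open>Flatness is a statement about normal fields that are smooth on the whole coordinate
  domain \<open>W\<close>, so a suitable vector \<nu> at one point is not enough: it must extend
  over \<open>W\<close> with \<open>J\<close> \<nu> staying normal. The CR condition bounds the
  complex rank of the tangent space by two at every point, but two constant coordinate directions
  that span it over the complex numbers at one point may become dependent elsewhere; the extension
  is built to survive this. The geometry is phrased with a complex-valued Hermitian form whose real
  part is the metric. One product rule for it packs metric compatibility and the parallelism of
  \<open>J\<close>, and one complex equation records orthogonality to both \<nu> and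
  \<open>J\<close> \<nu>. The constant -2 is ambient curvature: \<open>R(x, Jx)\<close> multiplies a
  vector that is Hermitian-orthogonal to \<open>x\<close> by \<open>-2 \<i> |x|^2\<close>. The Ricci
  equation needs second normal derivatives, while the normal part is a pointwise definite
  description; hence the work on tangential parts that depend differentiably on the point.\<close>

lemma times_differentiable_on_imp_continuous_on:
  "times_differentiable_on k S f \<Longrightarrow> continuous_on S f"
  by (cases k)
     (auto intro!: continuous_at_imp_continuous_on dest: differentiable_imp_continuous_within)

lemma times_differentiable_on_Suc_D: "times_differentiable_on (Suc k) S f \<Longrightarrow> times_differentiable_on k S f"
proof (induction k arbitrary: f)
  case 0
  then show ?case using times_differentiable_on_imp_continuous_on by fastforce
next
  case (Suc k)
  show ?case
    unfolding times_differentiable_on.simps(2)[of k]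
    using Suc.prems Suc.IH by (simp only: times_differentiable_on.simps(2)[of "Suc k"]) blast
qed

lemma times_differentiable_on_cong:
  assumes "open S" "\<And>x. x \<in> S \<Longrightarrow> f x = g x" "times_differentiable_on k S f"
  shows "times_differentiable_on k S g"
  using assms(2,3)
proof (induction k arbitrary: f g)
  case 0
  then show ?case using continuous_on_cong[of S S f g] by simp
next
  case (Suc k)
  have d: "(g has_derivative frechet_derivative f (at x)) (at x)" if "x \<in> S" for x
  proof -
    have "(f has_derivative frechet_derivative f (at x)) (at x)"
      using Suc.prems(2) that frechet_derivative_works by auto
    then show ?thesis
      by (rule has_derivative_transform_within_open[OF _ \<open>open S\<close> that]) (rule Suc.prems(1))
  qed
  have eq: "frechet_derivative f (at x) = frechet_derivative g (at x)" if "x \<in> S" for x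
    by (rule frechet_derivative_at[OF d[OF that]])
  show ?case
    using Suc.prems(2) d
    by (auto simp: differentiable_def intro!: Suc.IH[OF arg_cong2[where f="\<lambda>h v. h v", OF eq]])
qed

text \<open>The recursion speaks of \<open>frechet_derivative\<close>, a choice operator. Uniqueness
  of derivatives allows any explicit formula in its place, so that the closure properties reduce to
  the usual differentiation rules.\<close>

lemma times_differentiable_on_SucI:
  assumes "open S" "\<And>x. x \<in> S \<Longrightarrow> (f has_derivative f' x) (at x)"
    and "\<And>v. times_differentiable_on k S (\<lambda>x. f' x v)"
  shows "times_differentiable_on (Suc k) S f"
proof -
  have "f' x = frechet_derivative f (at x)" if "x \<in> S" for x
    by (rule frechet_derivative_at[OF assms(2)[OF that]])
  then show ?thesis
    using assms by (auto simp: differentiable_def intro!: times_differentiable_on_cong[OF assms(1) _ assms(3)])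
qed

lemma times_differentiable_on_const: "times_differentiable_on k S (\<lambda>x. c)"
  by (induction k arbitrary: c) auto

lemma times_differentiable_on_add:
  assumes "open S"
  shows "times_differentiable_on k S f \<Longrightarrow> times_differentiable_on k S g \<Longrightarrow>
    times_differentiable_on k S (\<lambda>x. f x + g x)"
proof (induction k arbitrary: f g)
  case 0
  then show ?case by (auto intro: continuous_intros)
next
  case (Suc k)
  show ?case
    by (rule times_differentiable_on_SucI[OF \<open>open S\<close>,
          of _ "\<lambda>x v. frechet_derivative f (at x) v + frechet_derivative g (at x) v"])
       (use Suc.prems in \<open>auto simp: frechet_derivative_works intro!: has_derivative_add Suc.IH\<close>)
qed

lemma times_differentiable_on_bounded_linear:
  assumes "open S" "bounded_linear L"
  shows "times_differentiable_on k S f \<Longrightarrow> times_differentiable_on k S (\<lambda>x. L (f x))"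
proof (induction k arbitrary: f)
  case 0
  then show ?case using assms by (auto intro: bounded_linear.continuous_on)
next
  case (Suc k)
  show ?case
    by (rule times_differentiable_on_SucI[OF \<open>open S\<close>, of _ "\<lambda>x v. L (frechet_derivative f (at x) v)"])
       (use Suc.prems in \<open>auto simp: frechet_derivative_works
          intro!: bounded_linear.has_derivative[OF assms(2)] Suc.IH\<close>)
qed

lemma times_differentiable_on_bounded_bilinear:
  assumes "open S" "bounded_bilinear B"
  shows "times_differentiable_on k S f \<Longrightarrow> times_differentiable_on k S g \<Longrightarrow>
    times_differentiable_on k S (\<lambda>x. B (f x) (g x))"
proof (induction k arbitrary: f g)
  case 0
  then show ?case using assms by (auto intro: bounded_bilinear.continuous_on)
next
  case (Suc k)
  show ?case
    by (rule times_differentiable_on_SucI[OF \<open>open S\<close>,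
          of _ "\<lambda>x v. B (f x) (frechet_derivative g (at x) v) + B (frechet_derivative f (at x) v) (g x)"])
       (use Suc.prems times_differentiable_on_Suc_D[OF Suc.prems(1)] times_differentiable_on_Suc_D[OF Suc.prems(2)]
         in \<open>auto simp: frechet_derivative_works
          intro!: bounded_bilinear.FDERIV[OF assms(2)] times_differentiable_on_add \<open>open S\<close> Suc.IH\<close>)
qed

lemma times_differentiable_on_inverse:
  fixes f :: "'a::real_normed_vector \<Rightarrow> 'b::real_normed_div_algebra"
  assumes "open S" "\<And>x. x \<in> S \<Longrightarrow> f x \<noteq> 0"
  shows "times_differentiable_on k S f \<Longrightarrow> times_differentiable_on k S (\<lambda>x. inverse (f x))"
proof (induction k)
  case 0
  then show ?case using assms by (auto intro!: continuous_intros)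
next
  case (Suc k)
  have inv: "times_differentiable_on k S (\<lambda>x. inverse (f x))"
    using Suc.IH times_differentiable_on_Suc_D[OF Suc.prems] .
  show ?case
  proof (rule times_differentiable_on_SucI[OF \<open>open S\<close>])
    show "((\<lambda>x. inverse (f x)) has_derivative
        (\<lambda>v. - (inverse (f x) * frechet_derivative f (at x) v * inverse (f x)))) (at x)" if "x \<in> S" for x
      using Suc.prems that assms(2)[OF that]
      by (intro Deriv.has_derivative_inverse) (auto simp: frechet_derivative_works)
    show "times_differentiable_on k S (\<lambda>x. - (inverse (f x) * frechet_derivative f (at x) v * inverse (f x)))" for v
      using Suc.prems
      by (intro times_differentiable_on_bounded_linear[OF \<open>open S\<close> bounded_linear_minus[OF bounded_linear_ident]]
          times_differentiable_on_bounded_bilinear[OF \<open>open S\<close> bounded_bilinear_mult] inv) auto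
  qed
qed

lemma smooth_on_const: "smooth_on S (\<lambda>x. c)"
  by (simp add: smooth_on_def times_differentiable_on_const)

lemma smooth_on_bounded_linear:
  "open S \<Longrightarrow> bounded_linear L \<Longrightarrow> smooth_on S f \<Longrightarrow> smooth_on S (\<lambda>x. L (f x))"
  by (simp add: smooth_on_def times_differentiable_on_bounded_linear)

lemma smooth_on_bounded_bilinear:
  "open S \<Longrightarrow> bounded_bilinear B \<Longrightarrow> smooth_on S f \<Longrightarrow> smooth_on S g \<Longrightarrow> smooth_on S (\<lambda>x. B (f x) (g x))"
  by (simp add: smooth_on_def times_differentiable_on_bounded_bilinear)

lemma smooth_on_add: "open S \<Longrightarrow> smooth_on S f \<Longrightarrow> smooth_on S g \<Longrightarrow> smooth_on S (\<lambda>x. f x + g x)"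
  by (simp add: smooth_on_def times_differentiable_on_add)

lemma smooth_on_diff:
  assumes "open S" "smooth_on S f" "smooth_on S g"
  shows "smooth_on S (\<lambda>x. f x - g x)"
  using smooth_on_add[OF assms(1,2) smooth_on_bounded_linear[OF assms(1) bounded_linear_minus[OF bounded_linear_ident] assms(3)]]
  by simp

lemma smooth_on_mult:
  fixes f g :: "'a::real_normed_vector \<Rightarrow> 'b::real_normed_algebra"
  shows "open S \<Longrightarrow> smooth_on S f \<Longrightarrow> smooth_on S g \<Longrightarrow> smooth_on S (\<lambda>x. f x * g x)"
  by (rule smooth_on_bounded_bilinear[OF _ bounded_bilinear_mult])

lemma smooth_on_divide:
  fixes f g :: "'a::real_normed_vector \<Rightarrow> 'b::real_normed_field"
  assumes "open S" "smooth_on S f" "smooth_on S g" "\<And>x. x \<in> S \<Longrightarrow> g x \<noteq> 0"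
  shows "smooth_on S (\<lambda>x. f x / g x)"
proof -
  have "smooth_on S (\<lambda>x. inverse (g x))"
    using assms by (simp add: smooth_on_def times_differentiable_on_inverse)
  then show ?thesis
    using smooth_on_mult[OF assms(1,2)] by (simp add: divide_inverse)
qed

lemma smooth_on_differentiable: "smooth_on S f \<Longrightarrow> x \<in> S \<Longrightarrow> f differentiable (at x)"
  unfolding smooth_on_def by (metis times_differentiable_on.simps(2))

lemma smooth_on_frechet_derivative: "smooth_on S f \<Longrightarrow> smooth_on S (\<lambda>x. frechet_derivative f (at x) v)"
  unfolding smooth_on_def by (metis times_differentiable_on.simps(2))

lemma smooth_on_imp_continuous_on: "smooth_on S f \<Longrightarrow> continuous_on S f"
  unfolding smooth_on_def using times_differentiable_on_imp_continuous_on by blast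

section \<open>Symmetry of second derivatives\<close>

lemma directional_field_derivative:
  fixes F :: "'a::real_normed_vector \<Rightarrow> real"
  assumes "F differentiable (at (p + s *\<^sub>R a))"
  shows "((\<lambda>s. F (p + s *\<^sub>R a)) has_real_derivative frechet_derivative F (at (p + s *\<^sub>R a)) a) (at s)"
proof -
  have F: "(F has_derivative frechet_derivative F (at (p + s *\<^sub>R a))) (at (p + s *\<^sub>R a))"
    using assms frechet_derivative_works by blast
  have "((\<lambda>s. p + s *\<^sub>R a) has_derivative (\<lambda>h. h *\<^sub>R a)) (at s)"
    by (auto intro!: derivative_eq_intros)
  from has_derivative_compose[OF this F] show ?thesis
    using linear_frechet_derivative[OF assms]
    by (simp add: has_field_derivative_def linear_cmul mult_commute_abs)
qed

text \<open>The mean value theorem is applied twice: in direction \<open>a\<close> to the difference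
  of \<open>F\<close> along two parallel sides of a parallelogram, and in direction \<open>b\<close>
  to the directional derivative so obtained.\<close>

lemma second_difference_mean_value:
  fixes F :: "'a::real_normed_vector \<Rightarrow> real"
  assumes W: "\<And>s r. 0 \<le> s \<Longrightarrow> s \<le> t \<Longrightarrow> 0 \<le> r \<Longrightarrow> r \<le> t \<Longrightarrow> u + s *\<^sub>R a + r *\<^sub>R b \<in> W"
    and "0 < t" and F: "smooth_on W F"
  obtains \<xi> \<eta> where "0 < \<xi>" "\<xi> < t" "0 < \<eta>" "\<eta> < t"
    "F (u + t *\<^sub>R a + t *\<^sub>R b) - F (u + t *\<^sub>R a) - F (u + t *\<^sub>R b) + F u
      = t\<^sup>2 * frechet_derivative (\<lambda>x. frechet_derivative F (at x) a) (at (u + \<xi> *\<^sub>R a + \<eta> *\<^sub>R b)) b"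
proof -
  define Fa where "Fa x = frechet_derivative F (at x) a" for x
  have Fa: "smooth_on W Fa" unfolding Fa_def by (rule smooth_on_frechet_derivative[OF F])
  define \<phi> where "\<phi> s = F (u + t *\<^sub>R b + s *\<^sub>R a) - F (u + s *\<^sub>R a)" for s
  have "\<exists>\<xi>>0. \<xi> < t \<and> \<phi> t - \<phi> 0 = (t - 0) * (Fa (u + t *\<^sub>R b + \<xi> *\<^sub>R a) - Fa (u + \<xi> *\<^sub>R a))"
  proof (rule MVT2[OF \<open>0 < t\<close>])
    fix s assume s: "0 \<le> s" "s \<le> t"
    have "u + t *\<^sub>R b + s *\<^sub>R a \<in> W" "u + s *\<^sub>R a \<in> W"
      using W[of s t] W[of s 0] s by (simp_all add: algebra_simps)
    then show "(\<phi> has_real_derivative Fa (u + t *\<^sub>R b + s *\<^sub>R a) - Fa (u + s *\<^sub>R a)) (at s)"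
      unfolding \<phi>_def Fa_def
      by (intro DERIV_diff directional_field_derivative smooth_on_differentiable[OF F])
  qed
  then obtain \<xi> where \<xi>: "0 < \<xi>" "\<xi> < t"
    "\<phi> t - \<phi> 0 = t * (Fa (u + t *\<^sub>R b + \<xi> *\<^sub>R a) - Fa (u + \<xi> *\<^sub>R a))" by auto
  have "\<exists>\<eta>>0. \<eta> < t \<and> Fa (u + \<xi> *\<^sub>R a + t *\<^sub>R b) - Fa (u + \<xi> *\<^sub>R a + 0 *\<^sub>R b)
      = (t - 0) * frechet_derivative Fa (at (u + \<xi> *\<^sub>R a + \<eta> *\<^sub>R b)) b"
    by (rule MVT2[OF \<open>0 < t\<close>])
       (use W \<xi> in \<open>auto intro!: directional_field_derivative smooth_on_differentiable[OF Fa]\<close>)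
  then obtain \<eta> where \<eta>: "0 < \<eta>" "\<eta> < t"
    "Fa (u + \<xi> *\<^sub>R a + t *\<^sub>R b) - Fa (u + \<xi> *\<^sub>R a) = t * frechet_derivative Fa (at (u + \<xi> *\<^sub>R a + \<eta> *\<^sub>R b)) b"
    by auto
  have "F (u + t *\<^sub>R a + t *\<^sub>R b) - F (u + t *\<^sub>R a) - F (u + t *\<^sub>R b) + F u = \<phi> t - \<phi> 0"
    by (simp add: \<phi>_def algebra_simps)
  also have "\<dots> = t * (Fa (u + \<xi> *\<^sub>R a + t *\<^sub>R b) - Fa (u + \<xi> *\<^sub>R a))"
    unfolding \<xi>(3) by (simp add: algebra_simps)
  also have "\<dots> = t\<^sup>2 * frechet_derivative Fa (at (u + \<xi> *\<^sub>R a + \<eta> *\<^sub>R b)) b"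
    unfolding \<eta>(3) by (simp add: power2_eq_square)
  finally show thesis using that \<xi> \<eta> unfolding Fa_def by blast
qed

lemma mixed_derivatives_commute_real:
  fixes F :: "'a::real_normed_vector \<Rightarrow> real"
  assumes "open W" "u \<in> W" and F: "smooth_on W F"
  shows "frechet_derivative (\<lambda>x. frechet_derivative F (at x) a) (at u) b
    = frechet_derivative (\<lambda>x. frechet_derivative F (at x) b) (at u) a"
proof -
  define D where "D a b x = frechet_derivative (\<lambda>x. frechet_derivative F (at x) a) (at x) b" for a b x
  \<comment> \<open>The second difference over a parallelogram is symmetric in \<open>a\<close> and
    \<open>b\<close>, so the two mixed derivatives agree at two points close to \<open>u\<close>,
    possibly different ones; continuity closes the gap.\<close>
  have near: "\<exists>p q. dist p u < \<epsilon> \<and> dist q u < \<epsilon> \<and> D a b p = D b a q" if "\<epsilon> > 0" for \<epsilon>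
  proof -
    obtain r where r: "r > 0" "ball u r \<subseteq> W" using \<open>open W\<close> \<open>u \<in> W\<close> openE by blast
    define \<delta> where "\<delta> = min r \<epsilon>"
    \<comment> \<open>Small enough for the whole parallelogram to lie in the ball. The summand 1
      keeps the denominator positive when \<open>a\<close> and \<open>b\<close> are both
      zero.\<close>
    define t where "t = \<delta> / (2 * (norm a + norm b + 1))"
    have "\<delta> > 0" using r that by (simp add: \<delta>_def)
    have n: "norm a + norm b + 1 > 0" by (intro add_nonneg_pos add_nonneg_nonneg norm_ge_zero) simp
    have "t > 0" using \<open>\<delta> > 0\<close> n by (simp add: t_def)
    \<comment> \<open>\<open>c\<close> and \<open>d\<close> stand for \<open>a\<close> and
      \<open>b\<close> in either order.\<close>
    have close: "dist (u + s *\<^sub>R c + s' *\<^sub>R d) u < \<delta>"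
      if "0 \<le> s" "s \<le> t" "0 \<le> s'" "s' \<le> t" "norm c + norm d = norm a + norm b" for s s' c d
    proof -
      have "dist (u + s *\<^sub>R c + s' *\<^sub>R d) u = norm (s *\<^sub>R c + s' *\<^sub>R d)" by (simp add: dist_norm)
      also have "\<dots> \<le> s * norm c + s' * norm d"
        using norm_triangle_ineq[of "s *\<^sub>R c" "s' *\<^sub>R d"] that by simp
      also have "\<dots> \<le> t * norm c + t * norm d"
        using that by (intro add_mono mult_right_mono) auto
      also have "\<dots> = t * (norm a + norm b)" using that(5) by (metis distrib_left)
      also have "\<dots> < t * (2 * (norm a + norm b + 1))"
        using \<open>t > 0\<close> n by (intro mult_strict_left_mono) (simp_all add: algebra_simps)
      also have "\<dots> = \<delta>" using n by (simp add: t_def)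
      finally show ?thesis .
    qed
    have inW: "u + s *\<^sub>R c + s' *\<^sub>R d \<in> W"
      if "0 \<le> s" "s \<le> t" "0 \<le> s'" "s' \<le> t" "norm c + norm d = norm a + norm b" for s s' c d
      using close[OF that] r by (auto simp: \<delta>_def dist_commute)
    obtain \<xi> \<eta> where 1: "0 < \<xi>" "\<xi> < t" "0 < \<eta>" "\<eta> < t"
      "F (u + t *\<^sub>R a + t *\<^sub>R b) - F (u + t *\<^sub>R a) - F (u + t *\<^sub>R b) + F u
        = t\<^sup>2 * D a b (u + \<xi> *\<^sub>R a + \<eta> *\<^sub>R b)"
      unfolding D_def by (rule second_difference_mean_value[OF _ \<open>t > 0\<close> F, of u a b]) (auto intro: inW)
    obtain \<xi>' \<eta>' where 2: "0 < \<xi>'" "\<xi>' < t" "0 < \<eta>'" "\<eta>' < t"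
      "F (u + t *\<^sub>R b + t *\<^sub>R a) - F (u + t *\<^sub>R b) - F (u + t *\<^sub>R a) + F u
        = t\<^sup>2 * D b a (u + \<xi>' *\<^sub>R b + \<eta>' *\<^sub>R a)"
      unfolding D_def
      by (rule second_difference_mean_value[OF _ \<open>t > 0\<close> F, of u b a]) (auto intro: inW)
    have swap: "u + t *\<^sub>R b + t *\<^sub>R a = u + t *\<^sub>R a + t *\<^sub>R b" by simp
    have "t\<^sup>2 * D a b (u + \<xi> *\<^sub>R a + \<eta> *\<^sub>R b) = t\<^sup>2 * D b a (u + \<xi>' *\<^sub>R b + \<eta>' *\<^sub>R a)"
      unfolding 1(5)[symmetric] 2(5)[symmetric] swap by (rule arg_cong2[where f="(+)"]) simp_all
    then have "D a b (u + \<xi> *\<^sub>R a + \<eta> *\<^sub>R b) = D b a (u + \<xi>' *\<^sub>R b + \<eta>' *\<^sub>R a)"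
      using \<open>t > 0\<close> by simp
    moreover have "dist (u + \<xi> *\<^sub>R a + \<eta> *\<^sub>R b) u < \<epsilon>" "dist (u + \<xi>' *\<^sub>R b + \<eta>' *\<^sub>R a) u < \<epsilon>"
      using close[of \<xi> \<eta> a b] close[of \<xi>' \<eta>' b a] 1 2 by (auto simp: \<delta>_def)
    ultimately show ?thesis by blast
  qed
  have cont: "isCont (D a b) u" for a b
    unfolding D_def using assms
    by (intro continuous_on_interior[of W] smooth_on_imp_continuous_on smooth_on_frechet_derivative)
       (auto simp: interior_open)
  have "D a b u = D b a u"
  proof (rule ccontr)
    assume "D a b u \<noteq> D b a u"
    define \<epsilon> where "\<epsilon> = \<bar>D a b u - D b a u\<bar> / 2"
    have "\<epsilon> > 0" using \<open>D a b u \<noteq> D b a u\<close> by (simp add: \<epsilon>_def)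
    then obtain \<delta>1 \<delta>2 where \<delta>: "\<delta>1 > 0" "\<delta>2 > 0"
      "\<And>x. dist x u < \<delta>1 \<Longrightarrow> dist (D a b x) (D a b u) < \<epsilon>"
      "\<And>x. dist x u < \<delta>2 \<Longrightarrow> dist (D b a x) (D b a u) < \<epsilon>"
      using cont[of a b] cont[of b a] unfolding continuous_at_eps_delta by metis
    from near[of "min \<delta>1 \<delta>2"] \<delta>(1,2) obtain p q
      where pq: "dist p u < \<delta>1" "dist q u < \<delta>2" "D a b p = D b a q" by auto
    have "dist (D a b p) (D a b u) < \<epsilon>" "dist (D a b p) (D b a u) < \<epsilon>"
      using \<delta>(3)[OF pq(1)] \<delta>(4)[OF pq(2)] pq(3) by simp_all
    then show False unfolding \<epsilon>_def dist_real_def by (simp add: abs_if split: if_splits)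
  qed
  then show ?thesis unfolding D_def .
qed

text \<open>The mean value theorem is confined to real values, hence the passage to
  components.\<close>

lemma mixed_derivatives_commute:
  fixes f :: "'a::real_normed_vector \<Rightarrow> 'b::euclidean_space"
  assumes "open W" "u \<in> W" and f: "smooth_on W f"
  shows "frechet_derivative (\<lambda>x. frechet_derivative f (at x) a) (at u) b
    = frechet_derivative (\<lambda>x. frechet_derivative f (at x) b) (at u) a"
proof (rule euclidean_eqI)
  fix k :: 'b
  have inner: "frechet_derivative (\<lambda>x. h x \<bullet> k) (at x) v = frechet_derivative h (at x) v \<bullet> k"
    if "h differentiable (at x)" for h :: "'a \<Rightarrow> 'b" and x v
    using that frechet_derivative_at[OF has_derivative_inner_left[of h "frechet_derivative h (at x)"]]
    by (simp add: frechet_derivative_works) metis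
  have second: "frechet_derivative (\<lambda>x. frechet_derivative f (at x) v) (at u) w \<bullet> k
      = frechet_derivative (\<lambda>x. frechet_derivative (\<lambda>x. f x \<bullet> k) (at x) v) (at u) w" for v w
  proof -
    have d: "(\<lambda>x. frechet_derivative f (at x) v) differentiable (at u)"
      using smooth_on_differentiable[OF smooth_on_frechet_derivative[OF f] \<open>u \<in> W\<close>] .
    have "frechet_derivative (\<lambda>x. frechet_derivative f (at x) v \<bullet> k) (at u)
        = frechet_derivative (\<lambda>x. frechet_derivative (\<lambda>x. f x \<bullet> k) (at x) v) (at u)"
      using d inner[OF smooth_on_differentiable[OF f]]
      by (intro frechet_derivative_transform_within_open[OF _ \<open>open W\<close> \<open>u \<in> W\<close>])
         (auto intro!: differentiable_compose[of "\<lambda>y. y \<bullet> k"] bounded_linear_imp_differentiable bounded_linear_inner_left)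
    then show ?thesis using inner[OF d] by metis
  qed
  have "smooth_on W (\<lambda>x. f x \<bullet> k)"
    by (rule smooth_on_bounded_linear[OF \<open>open W\<close> bounded_linear_inner_left f])
  then show "frechet_derivative (\<lambda>x. frechet_derivative f (at x) a) (at u) b \<bullet> k
    = frechet_derivative (\<lambda>x. frechet_derivative f (at x) b) (at u) a \<bullet> k"
    unfolding second by (rule mixed_derivatives_commute_real[OF assms(1,2)])
qed

section \<open>The Fubini-Study metric\<close>

lemma scaleR_eq_vector_scalar_mult: "r *\<^sub>R (v :: complex^'n) = complex_of_real r *s v"
  by (simp add: vec_eq_iff scaleR_conv_of_real[symmetric])

lemma bounded_bilinear_vector_scalar_mult: "bounded_bilinear (\<lambda>c (v :: complex^'n::finite). c *s v)"
  unfolding bilinear_conv_bounded_bilinear[symmetric] bilinear_def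
  by (auto intro!: linearI simp: vec_eq_iff algebra_simps)

lemma hermitian_add_left: "hermitian (a + b) c = hermitian a c + hermitian b c"
  and hermitian_add_right: "hermitian c (a + b) = hermitian c a + hermitian c b"
  and hermitian_scale_left: "hermitian (z *s a) c = z * hermitian a c"
  and hermitian_scale_right: "hermitian c (z *s a) = cnj z * hermitian c a"
  by (simp_all add: hermitian_def algebra_simps sum.distrib sum_distrib_left)

lemma hermitian_minus_left: "hermitian (- a) c = - hermitian a c"
  and hermitian_minus_right: "hermitian c (- a) = - hermitian c a"
  by (simp_all add: hermitian_def sum_negf)

lemma hermitian_diff_left: "hermitian (a - b) c = hermitian a c - hermitian b c"
  and hermitian_diff_right: "hermitian c (a - b) = hermitian c a - hermitian c b"
  by (simp_all add: hermitian_def algebra_simps sum_subtractf)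

lemmas hermitian_simps = hermitian_add_left hermitian_add_right hermitian_scale_left
  hermitian_scale_right hermitian_minus_left hermitian_minus_right hermitian_diff_left hermitian_diff_right

lemma cnj_hermitian: "cnj (hermitian a b) = hermitian b a"
  by (simp add: hermitian_def mult.commute)

lemma bounded_bilinear_hermitian: "bounded_bilinear (hermitian :: complex^'n::finite \<Rightarrow> _)"
  unfolding bilinear_conv_bounded_bilinear[symmetric] bilinear_def
  by (auto intro!: linearI
      simp: hermitian_simps scaleR_eq_vector_scalar_mult scaleR_conv_of_real)

lemma one_plus_hermitian_self:
  "1 + hermitian w w = complex_of_real (1 + (norm w)\<^sup>2)" "1 + hermitian w w \<noteq> 0"
proof -
  show 1: "1 + hermitian w w = complex_of_real (1 + (norm w)\<^sup>2)" by (simp add: hermitian_self)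
  have "1 + (norm w)\<^sup>2 \<noteq> 0" using zero_le_power2[of "norm w"] by linarith
  then show "1 + hermitian w w \<noteq> 0" unfolding 1 of_real_eq_0_iff .
qed

text \<open>The complex Hessian of the Kaehler potential \<open>log (1 + |w|^2)\<close>.\<close>

definition fs_hermitian :: "complex^'n \<Rightarrow> complex^'n \<Rightarrow> complex^'n \<Rightarrow> complex" where
  "fs_hermitian w a b =
     hermitian a b / (1 + hermitian w w) - hermitian a w * hermitian w b / (1 + hermitian w w)\<^sup>2"

text \<open>The holomorphic part of the differential of the potential
  \<open>log (1 + |w|^2)\<close>.\<close>

definition fs_form :: "complex^'n \<Rightarrow> complex^'n \<Rightarrow> complex" where
  "fs_form w a = hermitian a w / (1 + hermitian w w)"

text \<open>The connection form of the Kaehler metric. It is complex bilinear in \<open>a\<close>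
  and \<open>b\<close>, which is why multiplication by \<open>\<i>\<close> is parallel.\<close>

definition fs_christoffel :: "complex^'n \<Rightarrow> complex^'n \<Rightarrow> complex^'n \<Rightarrow> complex^'n" where
  "fs_christoffel w a b = - (fs_form w a *s b + fs_form w b *s a)"

lemma fubini_study_eq_Re: "fubini_study w a b = Re (fs_hermitian w a b)"
proof -
  let ?N = "1 + hermitian w w"
  have "N \<noteq> 0 \<Longrightarrow> x / N - y / N\<^sup>2 = (N * x - y) / N\<^sup>2" for N x y :: complex
    by (simp add: field_simps power2_eq_square)
  then have "fs_hermitian w a b = (?N * hermitian a b - hermitian a w * hermitian w b) / ?N\<^sup>2"
    unfolding fs_hermitian_def by (simp only: one_plus_hermitian_self(2) not_False_eq_True)
  also have "\<dots> = (?N * hermitian a b - hermitian a w * hermitian w b) / complex_of_real ((1 + (norm w)\<^sup>2)\<^sup>2)"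
    by (simp only: one_plus_hermitian_self(1) of_real_power)
  finally show ?thesis
    by (simp only: fubini_study_def Re_divide_of_real)
qed

lemma fs_hermitian_simps:
  "fs_hermitian w (a + b) c = fs_hermitian w a c + fs_hermitian w b c"
  "fs_hermitian w c (a + b) = fs_hermitian w c a + fs_hermitian w c b"
  "fs_hermitian w (a - b) c = fs_hermitian w a c - fs_hermitian w b c"
  "fs_hermitian w c (a - b) = fs_hermitian w c a - fs_hermitian w c b"
  "fs_hermitian w (z *s a) c = z * fs_hermitian w a c"
  "fs_hermitian w c (z *s a) = cnj z * fs_hermitian w c a"
  "fs_hermitian w (r *\<^sub>R a) c = of_real r * fs_hermitian w a c"
  "fs_hermitian w c (r *\<^sub>R a) = of_real r * fs_hermitian w c a"
  by (simp_all add: fs_hermitian_def scaleR_eq_vector_scalar_mult hermitian_simps add_divide_distrib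
      diff_divide_distrib algebra_simps)

lemma fs_hermitian_minus: "fs_hermitian w (- a) c = - fs_hermitian w a c" "fs_hermitian w c (- a) = - fs_hermitian w c a"
  by (simp_all add: fs_hermitian_def hermitian_simps)

lemma fs_hermitian_zero [simp]: "fs_hermitian w 0 c = 0" "fs_hermitian w c 0 = 0"
  by (simp_all add: fs_hermitian_def hermitian_def)

lemma cnj_fs_hermitian: "cnj (fs_hermitian w a b) = fs_hermitian w b a"
  by (simp add: fs_hermitian_def cnj_hermitian mult.commute)

lemma Cauchy_Schwarz_hermitian: "(cmod (hermitian a w))\<^sup>2 \<le> (norm a)\<^sup>2 * (norm w)\<^sup>2"
proof (cases "w = 0")
  case True
  then show ?thesis by (simp add: hermitian_def)
next
  case False
  \<comment> \<open>\<open>|w|^2\<close> times the part of \<open>a\<close> orthogonal to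
    \<open>w\<close>; the inequality is \<open>0 \<le> |c|^2\<close>.\<close>
  define c where "c = complex_of_real ((norm w)\<^sup>2) *s a - hermitian a w *s w"
  have "complex_of_real ((norm c)\<^sup>2) = hermitian c c" by (simp only: hermitian_self)
  also have "\<dots> = complex_of_real ((norm w)\<^sup>2) *
      (complex_of_real ((norm w)\<^sup>2) * hermitian a a - hermitian a w * cnj (hermitian a w))"
    unfolding c_def hermitian_simps cnj_hermitian complex_cnj_complex_of_real hermitian_self[of w]
    by (simp add: algebra_simps)
  also have "\<dots> = complex_of_real ((norm w)\<^sup>2 * ((norm w)\<^sup>2 * (norm a)\<^sup>2 - (cmod (hermitian a w))\<^sup>2))"
    by (simp only: hermitian_self complex_norm_square[symmetric] of_real_mult of_real_diff)
  finally have "(norm c)\<^sup>2 = (norm w)\<^sup>2 * ((norm w)\<^sup>2 * (norm a)\<^sup>2 - (cmod (hermitian a w))\<^sup>2)"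
    by (simp only: of_real_eq_iff)
  then have "0 \<le> (norm w)\<^sup>2 * ((norm w)\<^sup>2 * (norm a)\<^sup>2 - (cmod (hermitian a w))\<^sup>2)"
    by (metis zero_le_power2)
  moreover have "0 < (norm w)\<^sup>2" using False by simp
  ultimately show ?thesis by (simp add: zero_le_mult_iff mult.commute)
qed

lemma fs_hermitian_self:
  "fs_hermitian w a a = of_real (fubini_study w a a)"
  using cnj_fs_hermitian[of w a a] by (simp add: complex_eq_iff fubini_study_eq_Re)

lemma fubini_study_pos:
  assumes "a \<noteq> 0"
  shows "fubini_study w a a > 0"
proof -
  have "(1 + hermitian w w) * hermitian a a - hermitian a w * hermitian w a
      = complex_of_real ((1 + (norm w)\<^sup>2) * (norm a)\<^sup>2 - (cmod (hermitian a w))\<^sup>2)"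
    by (simp only: hermitian_self cnj_hermitian[of a w, symmetric] complex_norm_square[symmetric]
        of_real_mult of_real_diff of_real_add of_real_1)
  then have "fubini_study w a a
      = ((1 + (norm w)\<^sup>2) * (norm a)\<^sup>2 - (cmod (hermitian a w))\<^sup>2) / (1 + (norm w)\<^sup>2)\<^sup>2"
    by (simp only: fubini_study_def Re_complex_of_real)
  moreover have "(1 + (norm w)\<^sup>2) * (norm a)\<^sup>2 - (cmod (hermitian a w))\<^sup>2 > 0"
  proof -
    have "(norm a)\<^sup>2 > 0" using assms by simp
    with Cauchy_Schwarz_hermitian[of a w]
    have "(cmod (hermitian a w))\<^sup>2 < (norm a)\<^sup>2 + (norm a)\<^sup>2 * (norm w)\<^sup>2" by linarith
    then show ?thesis by (simp add: algebra_simps)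
  qed
  moreover have "(1 + (norm w)\<^sup>2)\<^sup>2 > 0"
    using zero_le_power2[of "norm w"] by (intro zero_less_power) linarith
  ultimately show ?thesis by simp
qed

lemma fs_hermitian_self_eq_0_iff [simp]: "fs_hermitian w a a = 0 \<longleftrightarrow> a = 0"
  using fubini_study_pos[of a w] by (cases "a = 0") (simp_all add: fs_hermitian_self[of w a])

text \<open>The summand with \<open>fs_hermitian\<close> is the antiholomorphic derivative in the
  base point. The curvature tensor will come from this summand alone.\<close>

lemma has_derivative_fs_form:
  fixes F :: "'e::real_normed_vector \<Rightarrow> complex^'n::finite"
  assumes F: "(F has_derivative F') (at u)" and V: "(V has_derivative V') (at u)"
  shows "((\<lambda>u. fs_form (F u) (V u)) has_derivative
    (\<lambda>h. fs_form (F u) (V' h) + fs_hermitian (F u) (V u) (F' h)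
        - fs_form (F u) (V u) * fs_form (F u) (F' h))) (at u)"
proof -
  note h = bounded_bilinear.FDERIV[OF bounded_bilinear_hermitian]
  have eq: "N \<noteq> 0 \<Longrightarrow> ((p + q) * N - r * (s + t)) / (N * N) = q / N + (p / N - r * s / N\<^sup>2) - r / N * (t / N)"
    for N p q r s t :: complex
    by (simp add: field_simps power2_eq_square)
  have "((\<lambda>u. fs_form (F u) (V u)) has_derivative
    (\<lambda>h. ((hermitian (V u) (F' h) + hermitian (V' h) (F u)) * (1 + hermitian (F u) (F u))
        - hermitian (V u) (F u) * (0 + (hermitian (F u) (F' h) + hermitian (F' h) (F u))))
        / ((1 + hermitian (F u) (F u)) * (1 + hermitian (F u) (F u))))) (at u)"
    unfolding fs_form_def
    by (rule has_derivative_divide'[OF h[OF V F]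
        has_derivative_add[OF has_derivative_const[of 1] h[OF F F]] one_plus_hermitian_self(2)])
  then show ?thesis
    unfolding add_0_left eq[OF one_plus_hermitian_self(2)] by (simp only: fs_form_def fs_hermitian_def)
qed

text \<open>The Fubini-Study connection is compatible even with the Hermitian form.\<close>

lemma has_derivative_fs_hermitian:
  fixes F :: "'e::real_normed_vector \<Rightarrow> complex^'n::finite"
  assumes F: "(F has_derivative F') (at u)" and V: "(V has_derivative V') (at u)"
    and Z: "(Z has_derivative Z') (at u)"
  shows "((\<lambda>u. fs_hermitian (F u) (V u) (Z u)) has_derivative
    (\<lambda>h. fs_hermitian (F u) (V' h + fs_christoffel (F u) (F' h) (V u)) (Z u)
       + fs_hermitian (F u) (V u) (Z' h + fs_christoffel (F u) (F' h) (Z u)))) (at u)"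
proof -
  note h = bounded_bilinear.FDERIV[OF bounded_bilinear_hermitian]
  define N where "N w = 1 + hermitian w w" for w :: "complex^'n"
  have N: "N w \<noteq> 0" for w unfolding N_def by (rule one_plus_hermitian_self)
  \<comment> \<open>In this form the second term can be differentiated by the rule for
    \<open>fs_form\<close>.\<close>
  have eq: "fs_hermitian w a b = hermitian a b / N w - fs_form w a * cnj (fs_form w b)" for w a b
    by (simp add: fs_hermitian_def fs_form_def cnj_hermitian power2_eq_square N_def)
  have split: "M \<noteq> 0 \<Longrightarrow> ((p + q) * M - r * (s + t)) / (M * M) = p / M + q / M - (r / M) * (s / M) - (r / M) * (t / M)"
    for M p q r s t :: complex
    by (simp add: field_simps power2_eq_square)
  have herm: "hermitian a b / N w = fs_hermitian w a b + fs_form w a * cnj (fs_form w b)"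
    "hermitian a w / N w = fs_form w a" "hermitian w a / N w = cnj (fs_form w a)" for w a b
    by (simp_all add: eq fs_form_def N_def cnj_hermitian)
  have cnj: "((\<lambda>u. cnj (fs_form (F u) (Z u))) has_derivative
    (\<lambda>h. cnj (fs_form (F u) (Z' h) + fs_hermitian (F u) (Z u) (F' h)
        - fs_form (F u) (Z u) * fs_form (F u) (F' h)))) (at u)"
    by (rule bounded_linear.has_derivative[OF bounded_linear_cnj has_derivative_fs_form[OF F Z]])
  have dN: "((\<lambda>u. N (F u)) has_derivative (\<lambda>h. hermitian (F u) (F' h) + hermitian (F' h) (F u))) (at u)"
    unfolding N_def using has_derivative_add[OF has_derivative_const[of 1] h[OF F F]] by simp
  have eqF: "(\<lambda>u. fs_hermitian (F u) (V u) (Z u))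
      = (\<lambda>u. hermitian (V u) (Z u) / N (F u) - fs_form (F u) (V u) * cnj (fs_form (F u) (Z u)))"
    unfolding eq ..
  have "((\<lambda>u. fs_hermitian (F u) (V u) (Z u)) has_derivative
      (\<lambda>h. ((hermitian (V u) (Z' h) + hermitian (V' h) (Z u)) * N (F u)
        - hermitian (V u) (Z u) * (hermitian (F u) (F' h) + hermitian (F' h) (F u))) / (N (F u) * N (F u))
      - (fs_form (F u) (V u) * cnj (fs_form (F u) (Z' h) + fs_hermitian (F u) (Z u) (F' h)
            - fs_form (F u) (Z u) * fs_form (F u) (F' h))
        + (fs_form (F u) (V' h) + fs_hermitian (F u) (V u) (F' h)
            - fs_form (F u) (V u) * fs_form (F u) (F' h)) * cnj (fs_form (F u) (Z u))))) (at u)"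
    unfolding eqF
    by (rule has_derivative_diff[OF has_derivative_divide'[OF h[OF V Z] dN N]
        has_derivative_mult[OF has_derivative_fs_form[OF F V] cnj]])
  then show ?thesis
    apply (rule has_derivative_eq_rhs)
    \<comment> \<open>The quotients with the base point as an argument are folded before the general
      rule, which would match them too.\<close>
    unfolding split[OF N] unfolding herm(2,3) unfolding herm(1)
    by (simp add: fun_eq_iff fs_christoffel_def fs_hermitian_simps fs_hermitian_minus cnj_fs_hermitian algebra_simps)
qed

lemma has_derivative_fubini_study:
  fixes F :: "'e::real_normed_vector \<Rightarrow> complex^'n::finite"
  assumes "(F has_derivative F') (at u)" "(V has_derivative V') (at u)" "(Z has_derivative Z') (at u)"
  shows "((\<lambda>u. fubini_study (F u) (V u) (Z u)) has_derivative
    (\<lambda>h. fubini_study (F u) (V' h + fs_christoffel (F u) (F' h) (V u)) (Z u)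
       + fubini_study (F u) (V u) (Z' h + fs_christoffel (F u) (F' h) (Z u)))) (at u)"
  using bounded_linear.has_derivative[OF bounded_linear_Re has_derivative_fs_hermitian[OF assms]]
  by (simp add: fubini_study_eq_Re)

lemma fs_christoffel_commute: "fs_christoffel w a b = fs_christoffel w b a"
  by (simp add: fs_christoffel_def add.commute)

lemma fubini_study_simps:
  "fubini_study w (a + b) c = fubini_study w a c + fubini_study w b c"
  "fubini_study w c (a + b) = fubini_study w c a + fubini_study w c b"
  "fubini_study w (a - b) c = fubini_study w a c - fubini_study w b c"
  "fubini_study w c (a - b) = fubini_study w c a - fubini_study w c b"
  "fubini_study w (r *\<^sub>R a) c = r * fubini_study w a c"
  "fubini_study w c (r *\<^sub>R a) = r * fubini_study w c a"
  "fubini_study w 0 c = 0" "fubini_study w c 0 = 0"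
  by (simp_all add: fubini_study_eq_Re fs_hermitian_simps)

lemma fubini_study_commute: "fubini_study w a b = fubini_study w b a"
  using arg_cong[OF cnj_fs_hermitian[of w a b], of Re] by (simp add: fubini_study_eq_Re)

text \<open>For constant fields the product rule expresses each term of the Koszul formula through
  \<open>fs_christoffel\<close>, and symmetry leaves twice one term. Positivity of the metric gives
  the uniqueness that \<open>THE\<close> requires.\<close>

lemma christoffel_fubini_study:
  fixes w a b :: "complex^'n::finite"
  shows "christoffel fubini_study w a b = fs_christoffel w a b"
proof -
  have d: "frechet_derivative (\<lambda>r. fubini_study r x y) (at w) v
      = fubini_study w (fs_christoffel w v x) y + fubini_study w x (fs_christoffel w v y)" for x y v :: "complex^'n"
    using frechet_derivative_at[OF has_derivative_fubini_study[OF has_derivative_ident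
        has_derivative_const has_derivative_const, of x y w]]
    by (simp add: fun_eq_iff)
  have rhs: "frechet_derivative (\<lambda>r. fubini_study r b d) (at w) a
     + frechet_derivative (\<lambda>r. fubini_study r a d) (at w) b
     - frechet_derivative (\<lambda>r. fubini_study r a b) (at w) d
     = 2 * fubini_study w (fs_christoffel w a b) d" for d
    unfolding d using fs_christoffel_commute fubini_study_commute by (smt (verit))
  show ?thesis
    unfolding christoffel_def rhs
  proof (rule the_equality)
    fix c assume "\<forall>d. 2 * fubini_study w c d = 2 * fubini_study w (fs_christoffel w a b) d"
    then have "fubini_study w (c - fs_christoffel w a b) (c - fs_christoffel w a b) = 0"
      by (simp add: fubini_study_simps)
    then show "c = fs_christoffel w a b"
      using fubini_study_pos[of "c - fs_christoffel w a b" w] by fastforce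
  qed simp
qed

section \<open>Fields along a map into projective space\<close>

lemma covariant_derivative_fubini_study:
  "covariant_derivative fubini_study f (\<lambda>_. v) V u =
     frechet_derivative V (at u) v + fs_christoffel (f u) (frechet_derivative f (at u) v) (V u)"
  by (simp add: covariant_derivative_def push_forward_def christoffel_fubini_study)

lemma frechet_derivative_fs_hermitian:
  fixes f :: "'e::euclidean_space \<Rightarrow> complex^'n::finite"
  assumes "f differentiable (at u)" "V differentiable (at u)" "Z differentiable (at u)"
  shows "frechet_derivative (\<lambda>u. fs_hermitian (f u) (V u) (Z u)) (at u) v
    = fs_hermitian (f u) (covariant_derivative fubini_study f (\<lambda>_. v) V u) (Z u)
      + fs_hermitian (f u) (V u) (covariant_derivative fubini_study f (\<lambda>_. v) Z u)"
  using frechet_derivative_at[OF has_derivative_fs_hermitian, of f _ u V _ Z] assms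
  by (simp add: frechet_derivative_works covariant_derivative_fubini_study fun_eq_iff)

lemma frechet_derivative_of_vanishing:
  assumes "open W" "u \<in> W" "\<And>x. x \<in> W \<Longrightarrow> h x = 0"
  shows "frechet_derivative h (at u) v = 0"
  using frechet_derivative_transform_within_open[of "\<lambda>_. 0" u W h] assms by (metis differentiable_const frechet_derivative_const)

text \<open>The left side is the full curvature, because constant fields have zero bracket. Terms
  with second derivatives cancel by symmetry. For \<open>fb = \<i> *s fa\<close> and
  \<open>V u = fb\<close> the right side is \<open>4 |fa|^2 fa\<close>, in accordance with
  holomorphic sectional curvature 4.\<close>

lemma fubini_study_curvature:
  fixes f :: "'e::euclidean_space \<Rightarrow> complex^'n::finite" and a b :: 'e
  assumes W: "open W" "u \<in> W" and f: "smooth_on W f" and V: "smooth_on W V"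
  defines "fa \<equiv> frechet_derivative f (at u) a" and "fb \<equiv> frechet_derivative f (at u) b"
  shows "covariant_derivative fubini_study f (\<lambda>_. a) (covariant_derivative fubini_study f (\<lambda>_. b) V) u
      - covariant_derivative fubini_study f (\<lambda>_. b) (covariant_derivative fubini_study f (\<lambda>_. a) V) u
    = (fs_hermitian (f u) fa fb - fs_hermitian (f u) fb fa) *s V u
      + fs_hermitian (f u) (V u) fb *s fa - fs_hermitian (f u) (V u) fa *s fb"
proof -
  define D where "D h v x = frechet_derivative h (at x) v" for h :: "'e \<Rightarrow> complex^'n" and v x
  define \<theta> where "\<theta> = fs_form (f u)"
  define G where "G = fs_hermitian (f u)"
  have works: "(h has_derivative (\<lambda>v. D h v u)) (at u)" if "smooth_on W h" for h
    unfolding D_def using smooth_on_differentiable[OF that W(2)] frechet_derivative_works by blast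
  have D2: "smooth_on W (D h v)" if "smooth_on W h" for h v
    unfolding D_def[abs_def] by (rule smooth_on_frechet_derivative[OF that])
  have sym: "D (D h a) b u = D (D h b) a u" if "smooth_on W h" for h
    using mixed_derivatives_commute[OF W that] unfolding D_def[abs_def] .
  have 1: "covariant_derivative fubini_study f (\<lambda>_. v) V
      = (\<lambda>x. D V v x - (fs_form (f x) (D f v x) *s V x + fs_form (f x) (V x) *s D f v x))" for v
    by (simp add: fun_eq_iff covariant_derivative_fubini_study fs_christoffel_def D_def)
  have "((\<lambda>x. D V v x - (fs_form (f x) (D f v x) *s V x + fs_form (f x) (V x) *s D f v x)) has_derivative
      (\<lambda>w. D (D V v) w u - (\<theta> (D f v u) *s D V w u
        + (\<theta> (D (D f v) w u) + G (D f v u) (D f w u) - \<theta> (D f v u) * \<theta> (D f w u)) *s V u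
        + (\<theta> (V u) *s D (D f v) w u + (\<theta> (D V w u) + G (V u) (D f w u) - \<theta> (V u) * \<theta> (D f w u)) *s D f v u))))
      (at u)" for v
    unfolding \<theta>_def G_def
    by (intro has_derivative_diff has_derivative_add works f V D2 has_derivative_fs_form
        bounded_bilinear.FDERIV[OF bounded_bilinear_vector_scalar_mult])
  from frechet_derivative_at[OF this]
  have 2: "covariant_derivative fubini_study f (\<lambda>_. w) (covariant_derivative fubini_study f (\<lambda>_. v) V) u
      = D (D V v) w u - (\<theta> (D f v u) *s D V w u
        + (\<theta> (D (D f v) w u) + G (D f v u) (D f w u) - \<theta> (D f v u) * \<theta> (D f w u)) *s V u
        + (\<theta> (V u) *s D (D f v) w u + (\<theta> (D V w u) + G (V u) (D f w u) - \<theta> (V u) * \<theta> (D f w u)) *s D f v u))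
        - (\<theta> (D f w u) *s (D V v u - (\<theta> (D f v u) *s V u + \<theta> (V u) *s D f v u))
          + \<theta> (D V v u - (\<theta> (D f v u) *s V u + \<theta> (V u) *s D f v u)) *s D f w u)" for v w
    by (subst covariant_derivative_fubini_study)
       (simp add: 1 fs_christoffel_def fun_eq_iff D_def[symmetric] \<theta>_def)
  have \<theta>: "\<theta> (x + y) = \<theta> x + \<theta> y" "\<theta> (x - y) = \<theta> x - \<theta> y" "\<theta> (c *s x) = c * \<theta> x" for x y c
    by (simp_all add: \<theta>_def fs_form_def hermitian_simps add_divide_distrib diff_divide_distrib)
  have fab: "D f a u = fa" "D f b u = fb" by (simp_all add: D_def fa_def fb_def)
  show ?thesis
    unfolding 2 G_def[symmetric] sym[OF V] sym[OF f] fab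
    by (simp add: vec_eq_iff \<theta> algebra_simps)
qed

lemma smooth_on_fs_form:
  assumes "open W" "smooth_on W F" "smooth_on W V"
  shows "smooth_on W (\<lambda>u. fs_form (F u) (V u))"
  unfolding fs_form_def
  by (intro smooth_on_divide smooth_on_add smooth_on_const one_plus_hermitian_self assms
      smooth_on_bounded_bilinear[OF _ bounded_bilinear_hermitian])

lemma smooth_on_fs_hermitian:
  assumes "open W" "smooth_on W F" "smooth_on W V" "smooth_on W Z"
  shows "smooth_on W (\<lambda>u. fs_hermitian (F u) (V u) (Z u))"
proof -
  have "(1 + hermitian w w)\<^sup>2 \<noteq> 0" for w :: "complex^'n" using one_plus_hermitian_self(2)[of w] by simp
  then show ?thesis
    unfolding fs_hermitian_def power2_eq_square
    by (intro smooth_on_divide smooth_on_diff smooth_on_add smooth_on_mult smooth_on_const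
        one_plus_hermitian_self assms smooth_on_bounded_bilinear[OF _ bounded_bilinear_hermitian])
qed

lemma smooth_on_scale:
  fixes V :: "'e::real_normed_vector \<Rightarrow> complex^'n::finite"
  shows "open W \<Longrightarrow> smooth_on W c \<Longrightarrow> smooth_on W V \<Longrightarrow> smooth_on W (\<lambda>u. c u *s V u)"
  by (rule smooth_on_bounded_bilinear[OF _ bounded_bilinear_vector_scalar_mult])

section \<open>Tangential and normal parts along an immersion in one pair of charts\<close>

locale projective_immersion =
  fixes W :: "'e::euclidean_space set" and f :: "'e \<Rightarrow> complex^'n::finite"
  assumes open_W: "open W" and smooth_f: "smooth_on W f"
    and inj_df: "\<And>u. u \<in> W \<Longrightarrow> inj (frechet_derivative f (at u))"
begin

abbreviation d :: "'e \<Rightarrow> 'e \<Rightarrow> complex^'n" where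
  "d v u \<equiv> frechet_derivative f (at u) v"

abbreviation nab :: "'e \<Rightarrow> ('e \<Rightarrow> complex^'n) \<Rightarrow> 'e \<Rightarrow> complex^'n" where
  "nab v \<equiv> covariant_derivative fubini_study f (\<lambda>_. v)"

lemma linear_d: "u \<in> W \<Longrightarrow> linear (\<lambda>v. d v u)"
  using linear_frechet_derivative[OF smooth_on_differentiable[OF smooth_f]] by simp

lemmas d_simps = linear_add[OF linear_d] linear_diff[OF linear_d] linear_cmul[OF linear_d] linear_0[OF linear_d]

lemma d_inject: "u \<in> W \<Longrightarrow> d v u = d w u \<longleftrightarrow> v = w"
  using inj_df by (auto dest: injD)

lemma d_eq_0_iff: "u \<in> W \<Longrightarrow> d v u = 0 \<longleftrightarrow> v = 0"
  using d_inject[of u v 0] by (simp add: d_simps)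

lemma smooth_d: "smooth_on W (\<lambda>u. d v u)"
  by (rule smooth_on_frechet_derivative[OF smooth_f])

text \<open>Point and direction vary together; expanding \<tau> in the basis separates them into
  differentiable coefficients and the smooth fields \<open>d b\<close>.\<close>

lemma differentiable_d_field:
  assumes "u \<in> W" "\<tau> differentiable (at u)"
  shows "(\<lambda>u. d (\<tau> u) u) differentiable (at u)"
proof -
  have eq: "(\<Sum>b\<in>Basis. (\<tau> x \<bullet> b) *\<^sub>R d b x) = d (\<tau> x) x" if "x \<in> W" for x
    using linear_sum[OF linear_d[OF that], of "\<lambda>b. (\<tau> x \<bullet> b) *\<^sub>R b" Basis]
    by (simp add: d_simps that euclidean_representation)
  have "(\<lambda>x. \<Sum>b\<in>Basis. (\<tau> x \<bullet> b) *\<^sub>R d b x) differentiable (at u)"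
    using assms smooth_on_differentiable[OF smooth_d \<open>u \<in> W\<close>]
    by (intro differentiable_sum differentiable_scaleR differentiable_inner differentiable_const) auto
  then obtain D where "((\<lambda>x. \<Sum>b\<in>Basis. (\<tau> x \<bullet> b) *\<^sub>R d b x) has_derivative D) (at u)"
    unfolding differentiable_def ..
  from has_derivative_transform_within_open[OF this open_W \<open>u \<in> W\<close> eq] show ?thesis
    by (auto simp: differentiable_def)
qed

lemma differentiable_fubini_study:
  assumes "u \<in> W" "V differentiable (at u)" "Z differentiable (at u)"
  shows "(\<lambda>u. fubini_study (f u) (V u) (Z u)) differentiable (at u)"
  using has_derivative_fubini_study[of f _ u V _ Z] smooth_on_differentiable[OF smooth_f] assms
  unfolding differentiable_def by blast

text \<open>Gram-Schmidt: one more direction \<open>b\<close> is first made orthogonal to the previous ones.\<close>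

lemma tangential_part_span:
  assumes "finite B" "independent B" "\<And>u. u \<in> W \<Longrightarrow> V differentiable (at u)"
  shows "\<exists>\<tau>. (\<forall>u\<in>W. \<tau> differentiable (at u) \<and> \<tau> u \<in> span B \<and>
    (\<forall>c\<in>B. fubini_study (f u) (V u - d (\<tau> u) u) (d c u) = 0))"
  using assms
proof (induction B arbitrary: V rule: finite_induct)
  case empty
  show ?case by (rule exI[of _ "\<lambda>_. 0"]) (simp add: span_0)
next
  case (insert b B)
  have ind: "independent B" "b \<notin> span B" using insert.prems(1) insert.hyps(2) by (simp_all add: independent_insert)
  obtain \<sigma> where \<sigma>: "\<And>u. u \<in> W \<Longrightarrow> \<sigma> differentiable (at u)" "\<And>u. u \<in> W \<Longrightarrow> \<sigma> u \<in> span B"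
    "\<And>u c. u \<in> W \<Longrightarrow> c \<in> B \<Longrightarrow> fubini_study (f u) (d b u - d (\<sigma> u) u) (d c u) = 0"
    using insert.IH[OF ind(1), of "\<lambda>u. d b u"] smooth_on_differentiable[OF smooth_d] by blast
  obtain \<rho> where \<rho>: "\<And>u. u \<in> W \<Longrightarrow> \<rho> differentiable (at u)" "\<And>u. u \<in> W \<Longrightarrow> \<rho> u \<in> span B"
    "\<And>u c. u \<in> W \<Longrightarrow> c \<in> B \<Longrightarrow> fubini_study (f u) (V u - d (\<rho> u) u) (d c u) = 0"
    using insert.IH[OF ind(1) insert.prems(2)] by blast
  \<comment> \<open>The part of \<open>d b\<close> orthogonal to the earlier directions. It has no
    zeros on \<open>W\<close>, since \<open>b\<close> is not in \<open>span B\<close> and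
    \<open>d\<close> is injective.\<close>
  define e where "e u = d b u - d (\<sigma> u) u" for u
  define k where "k u = fubini_study (f u) (V u - d (\<rho> u) u) (e u) / fubini_study (f u) (e u) (e u)" for u
  have e: "e differentiable (at u)" "fubini_study (f u) (e u) (e u) \<noteq> 0" if "u \<in> W" for u
  proof -
    show "e differentiable (at u)" unfolding e_def
      using that by (intro differentiable_diff differentiable_d_field differentiable_const \<sigma>(1))
    have "b \<noteq> \<sigma> u" using \<sigma>(2)[OF that] ind(2) by auto
    then have "e u \<noteq> 0" using d_inject[OF that] by (simp add: e_def)
    then show "fubini_study (f u) (e u) (e u) \<noteq> 0" using fubini_study_pos[of "e u" "f u"] by simp
  qed
  have span: "fubini_study (f u) h (d c u) = 0" if "u \<in> W" "c \<in> span B" "\<And>c. c \<in> B \<Longrightarrow> fubini_study (f u) h (d c u) = 0"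
    for u h c
  proof -
    have "linear (\<lambda>c. fubini_study (f u) h (d c u))"
      by (rule linearI) (simp_all add: d_simps \<open>u \<in> W\<close> fubini_study_simps)
    from linear_eq_0_on_span[OF this _ that(2)] show ?thesis using that(3) by blast
  qed
  define \<tau> where "\<tau> u = \<rho> u + k u *\<^sub>R (b - \<sigma> u)" for u
  have "\<tau> differentiable (at u) \<and> \<tau> u \<in> span (insert b B) \<and>
    (\<forall>c\<in>insert b B. fubini_study (f u) (V u - d (\<tau> u) u) (d c u) = 0)" if u: "u \<in> W" for u
  proof (intro conjI ballI)
    show "\<tau> differentiable (at u)"
      unfolding \<tau>_def k_def using u
      by (intro differentiable_add differentiable_scaleR differentiable_divide differentiable_diff
          differentiable_const differentiable_fubini_study differentiable_d_field \<rho>(1) \<sigma>(1) e insert.prems(2))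
    have "\<sigma> u \<in> span (insert b B)" "\<rho> u \<in> span (insert b B)"
      using \<sigma>(2)[OF u] \<rho>(2)[OF u] span_mono[of B "insert b B"] by auto
    then show "\<tau> u \<in> span (insert b B)"
      unfolding \<tau>_def by (intro span_add span_scale span_diff) (simp_all add: span_base)
    have d\<tau>: "V u - d (\<tau> u) u = V u - d (\<rho> u) u - k u *\<^sub>R e u"
      by (simp add: \<tau>_def e_def d_simps u)
    have B: "fubini_study (f u) (V u - d (\<tau> u) u) (d c u) = 0" if "c \<in> B" for c
      using \<rho>(3)[OF u that] \<sigma>(3)[OF u that] unfolding d\<tau> e_def[symmetric] by (simp add: fubini_study_simps)
    fix c assume "c \<in> insert b B"
    then show "fubini_study (f u) (V u - d (\<tau> u) u) (d c u) = 0"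
    proof
      assume "c = b"
      have "d b u = e u + d (\<sigma> u) u" by (simp add: e_def)
      moreover have "fubini_study (f u) (V u - d (\<tau> u) u) (e u) = 0"
        unfolding d\<tau> using e(2)[OF u] by (simp add: fubini_study_simps(3,5) k_def)
      moreover have "fubini_study (f u) (V u - d (\<tau> u) u) (d (\<sigma> u) u) = 0"
        using span[OF u \<sigma>(2)[OF u] B] .
      ultimately show ?thesis using \<open>c = b\<close> by (simp only: fubini_study_simps(2))
    qed (rule B)
  qed
  then show ?case by blast
qed

text \<open>Together with \<open>normal_part_eq\<close> this makes the normal part of a
  differentiable field differentiable, so that the normal connection can be applied again.\<close>

lemma tangential_part:
  assumes "\<And>u. u \<in> W \<Longrightarrow> V differentiable (at u)"
  obtains \<tau> where "\<And>u. u \<in> W \<Longrightarrow> \<tau> differentiable (at u)"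
    "\<And>u c. u \<in> W \<Longrightarrow> fubini_study (f u) (V u - d (\<tau> u) u) (d c u) = 0"
proof -
  obtain \<tau> where \<tau>: "\<And>u. u \<in> W \<Longrightarrow> \<tau> differentiable (at u)"
    "\<And>u c. u \<in> W \<Longrightarrow> c \<in> Basis \<Longrightarrow> fubini_study (f u) (V u - d (\<tau> u) u) (d c u) = 0"
    using tangential_part_span[OF finite_Basis independent_Basis assms] by metis
  have "fubini_study (f u) (V u - d (\<tau> u) u) (d c u) = 0" if u: "u \<in> W" for u c
  proof -
    have "linear (\<lambda>c. fubini_study (f u) (V u - d (\<tau> u) u) (d c u))"
      by (rule linearI) (simp_all add: d_simps u fubini_study_simps)
    from linear_eq_0_on_span[OF this, of Basis c] show ?thesis using \<tau>(2)[OF u] by simp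
  qed
  with \<tau>(1) show thesis using that by blast
qed

text \<open>Two candidates differ by a vector that is both tangent and normal, hence zero by
  positivity.\<close>

lemma normal_part_eq:
  assumes u: "u \<in> W" and perp: "\<And>c. fubini_study (f u) (v - d t u) (d c u) = 0"
  shows "normal_part fubini_study f u v = v - d t u"
  unfolding normal_part_def
proof (rule the_equality)
  show "v - d t u \<in> normal_space fubini_study f u \<and> v - (v - d t u) \<in> tangent_space f u"
    using perp by (auto simp: normal_space_def tangent_space_def)
  fix w assume "w \<in> normal_space fubini_study f u \<and> v - w \<in> tangent_space f u"
  then obtain s where s: "\<And>c. fubini_study (f u) w (d c u) = 0" "v - w = d s u"
    by (auto simp: normal_space_def tangent_space_def)
  have eq: "w - (v - d t u) = d (t - s) u" using s(2) by (simp add: d_simps u algebra_simps)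
  have "fubini_study (f u) (w - (v - d t u)) (d (t - s) u) = 0"
    using s(1) perp by (simp only: fubini_study_simps(3))
  then have "w - (v - d t u) = 0"
    unfolding eq using fubini_study_pos[of "d (t - s) u" "f u"] by fastforce
  then show "w = v - d t u" by simp
qed

text \<open>This removes the outer projection of an iterated normal connection once it is paired
  with a normal vector.\<close>

lemma normal_part_pairing:
  assumes u: "u \<in> W" and \<mu>: "\<And>c. fubini_study (f u) (d c u) \<mu> = 0"
  shows "fubini_study (f u) (normal_part fubini_study f u v) \<mu> = fubini_study (f u) v \<mu>"
proof -
  obtain \<tau> where "\<And>c. fubini_study (f u) (v - d (\<tau> u) u) (d c u) = 0"
    using tangential_part[of "\<lambda>_. v"] u by (metis differentiable_const)
  from normal_part_eq[OF u this] show ?thesis using \<mu> by (simp add: fubini_study_simps)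
qed

text \<open>The explicit formula for the normal connection is available only on \<open>W\<close>;
  openness makes that enough for differentiating it.\<close>

lemma nab_cong:
  assumes "u \<in> W" "V differentiable (at u)" "\<And>x. x \<in> W \<Longrightarrow> Z x = V x"
  shows "nab v Z u = nab v V u"
  unfolding covariant_derivative_fubini_study
  using frechet_derivative_transform_within_open[OF assms(2) open_W assms(1), of Z] assms by simp

lemma nab_diff:
  assumes "u \<in> W" "V differentiable (at u)" "Z differentiable (at u)"
  shows "nab v (\<lambda>x. V x - Z x) u = nab v V u - nab v Z u"
proof -
  have "frechet_derivative (\<lambda>x. V x - Z x) (at u) v = frechet_derivative V (at u) v - frechet_derivative Z (at u) v"
  proof -
    have "((\<lambda>x. V x - Z x) has_derivative (\<lambda>h. frechet_derivative V (at u) h - frechet_derivative Z (at u) h)) (at u)"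
      using assms by (intro has_derivative_diff) (simp_all add: frechet_derivative_works)
    from frechet_derivative_at[OF this] show ?thesis by (rule fun_cong[OF sym])
  qed
  then show ?thesis
    by (simp add: covariant_derivative_fubini_study fs_christoffel_def fs_form_def hermitian_simps
        diff_divide_distrib vec_eq_iff algebra_simps)
qed

lemma smooth_nab:
  assumes "smooth_on W V"
  shows "smooth_on W (nab v V)"
proof -
  have eq: "nab v V = (\<lambda>u. frechet_derivative V (at u) v - (fs_form (f u) (d v u) *s V u + fs_form (f u) (V u) *s d v u))"
    by (simp add: fun_eq_iff covariant_derivative_fubini_study fs_christoffel_def)
  show ?thesis unfolding eq
    by (intro smooth_on_diff smooth_on_add smooth_on_scale smooth_on_fs_form open_W smooth_f smooth_d assms
        smooth_on_frechet_derivative[OF assms])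
qed

text \<open>Absence of torsion, the source of the symmetry of the shape operators.\<close>

lemma nab_d_commute: "u \<in> W \<Longrightarrow> nab a (\<lambda>u. d b u) u = nab b (\<lambda>u. d a u) u"
  using mixed_derivatives_commute[OF open_W _ smooth_f, of u a b]
  by (simp add: covariant_derivative_fubini_study fs_christoffel_commute)

lemma lie_bracket_const: "lie_bracket (\<lambda>_. x) (\<lambda>_. y) = (\<lambda>_. 0)"
  by (simp add: fun_eq_iff lie_bracket_def)

text \<open>
  In the proof \<open>t v\<close> is the tangential part of \<open>\<nabla>\<^sub>v \<nu>\<close>, that is, \<open>- A v\<close> for the shape operator
  \<open>A\<close> of \<open>\<nu>\<close>.  Orthogonality of \<open>\<nu>\<close> for the Hermitian form says that \<open>J\<nu>\<close> is normal too.
\<close>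

lemma normal_curvature_nonzero:
  assumes u: "u \<in> W" and xy: "d y u = \<i> *s d x u" and \<nu>: "smooth_on W \<nu>"
    and perp: "\<And>u c. u \<in> W \<Longrightarrow> fs_hermitian (f u) (\<nu> u) (d c u) = 0"
    and flat: "normal_curvature fubini_study f (\<lambda>_. x) (\<lambda>_. y) \<nu> u = 0"
  shows "x = 0 \<or> \<nu> u = 0"
proof -
  let ?G = "fs_hermitian (f u)" and ?g = "fubini_study (f u)"
  have perp': "fs_hermitian (f u) (d c u) (\<nu> u) = 0" if "u \<in> W" for u c
    using perp[OF that, of c] cnj_fs_hermitian[of "f u" "\<nu> u" "d c u"] by simp
  have diff_nab: "nab v \<nu> differentiable (at w)" if "w \<in> W" for v w
    using smooth_on_differentiable[OF smooth_nab[OF \<nu>] that] .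
  have "\<exists>\<tau>. (\<forall>u\<in>W. \<tau> differentiable (at u)) \<and>
    (\<forall>u\<in>W. \<forall>c. fubini_study (f u) (nab v \<nu> u - d (\<tau> u) u) (d c u) = 0)" for v
    using tangential_part[of "nab v \<nu>", OF diff_nab] by metis
  then obtain T where T: "\<And>v u. u \<in> W \<Longrightarrow> T v differentiable (at u)"
    "\<And>v u c. u \<in> W \<Longrightarrow> fubini_study (f u) (nab v \<nu> u - d (T v u) u) (d c u) = 0"
    by metis
  define t where "t v w = d (T v w) w" for v w
  have diff_t: "t v differentiable (at u)" for v
    unfolding t_def by (rule differentiable_d_field[OF u T(1)[OF u]])
  have nc: "normal_connection fubini_study f (\<lambda>_. v) \<nu> w = nab v \<nu> w - t v w" if "w \<in> W" for v w
    unfolding normal_connection_def t_def using normal_part_eq[OF that T(2)[OF that]] .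
  have nab_nc: "nab w (normal_connection fubini_study f (\<lambda>_. v) \<nu>) u = nab w (nab v \<nu>) u - nab w (t v) u" for v w
    using nab_cong[OF u differentiable_diff[OF diff_nab[OF u] diff_t] nc]
      nab_diff[OF u diff_nab[OF u] diff_t] by simp
  have J\<nu>: "?g (d c u) (\<i> *s \<nu> u) = 0" for c
    by (simp add: fubini_study_eq_Re fs_hermitian_simps perp'[OF u])
  have pairing: "?g (normal_connection fubini_study f (\<lambda>_. w) (normal_connection fubini_study f (\<lambda>_. v) \<nu>) u) (\<i> *s \<nu> u)
      = ?g (nab w (nab v \<nu>) u - nab w (t v) u) (\<i> *s \<nu> u)" for v w
    unfolding normal_connection_def[of _ _ _ "normal_connection _ _ _ _"] normal_part_pairing[OF u J\<nu>] nab_nc ..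
  have "nab 0 \<nu> u = 0"
    using linear_0[OF linear_frechet_derivative[OF smooth_on_differentiable[OF \<nu> u]]]
      linear_0[OF linear_d[OF u]]
    by (simp add: covariant_derivative_fubini_study fs_christoffel_def fs_form_def hermitian_def)
  then have bracket: "normal_connection fubini_study f (\<lambda>_. 0) \<nu> u = 0"
    using normal_part_eq[OF u, of 0 0] by (simp add: normal_connection_def d_simps u fubini_study_simps)
  have "?g (nab x (nab y \<nu>) u - nab x (t y) u) (\<i> *s \<nu> u) - ?g (nab y (nab x \<nu>) u - nab y (t x) u) (\<i> *s \<nu> u) = 0"
    using arg_cong[OF flat, of "\<lambda>v. ?g v (\<i> *s \<nu> u)"]
    unfolding normal_curvature_def lie_bracket_const bracket diff_0_right fubini_study_simps(3) pairing
    by (simp add: fubini_study_simps)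
  then have ricci: "?g (nab x (nab y \<nu>) u - nab y (nab x \<nu>) u) (\<i> *s \<nu> u)
      - ?g (nab x (t y) u) (\<i> *s \<nu> u) + ?g (nab y (t x) u) (\<i> *s \<nu> u) = 0"
    by (simp add: fubini_study_simps)
  \<comment> \<open>With \<open>d y u = \<i> *s d x u\<close> the curvature applied to \<nu> is
    \<open>-2 \<i> |d x u|^2\<close> times \<nu>; its other two terms vanish by
    \<open>perp\<close>.\<close>
  have curv: "?g (nab x (nab y \<nu>) u - nab y (nab x \<nu>) u) (\<i> *s \<nu> u) = - 2 * ?g (d x u) (d x u) * ?g (\<nu> u) (\<nu> u)"
    unfolding fubini_study_curvature[OF open_W u smooth_f \<nu>] xy
    by (simp add: fubini_study_eq_Re[of _ _ "\<i> *s \<nu> u"] fs_hermitian_simps fs_hermitian_minus perp[OF u] perp'[OF u] fs_hermitian_self[of "f u"])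
  \<comment> \<open>The product of \<open>V\<close> and \<nu> vanishes on all of \<open>W\<close>,
    hence so does its derivative. As the values are complex, this also covers the product with
    \<open>J\<close> \<nu>.\<close>
  have move: "?G (nab w V u) (\<nu> u) = - ?G (V u) (nab w \<nu> u)"
    if "V differentiable (at u)" "\<And>u. u \<in> W \<Longrightarrow> fs_hermitian (f u) (V u) (\<nu> u) = 0" for V w
    using frechet_derivative_fs_hermitian[OF smooth_on_differentiable[OF smooth_f u] that(1)
        smooth_on_differentiable[OF \<nu> u], of w] frechet_derivative_of_vanishing[OF open_W u that(2)]
    by (simp add: eq_neg_iff_add_eq_0)
  \<comment> \<open>Symmetry of the shape operators of \<nu> and \<open>J\<close> \<nu>, as real and
    imaginary part of one equation.\<close>
  have shape: "?G (d c u) (nab w \<nu> u) = ?G (d w u) (nab c \<nu> u)" for c w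
    using move[OF smooth_on_differentiable[OF smooth_d u] perp', of w c]
      move[OF smooth_on_differentiable[OF smooth_d u] perp', of c w] nab_d_commute[OF u, of w c]
    by simp
  \<comment> \<open>\<open>shape\<close> moves \<open>y\<close> into the first slot, where it turns
    into \<open>\<i>\<close> times \<open>x\<close>, and moves \<open>x\<close> back.\<close>
  have shape_J: "?G (d c u) (nab y \<nu> u) = \<i> * ?G (d c u) (nab x \<nu> u)" for c
    unfolding shape[of c] xy by (simp add: fs_hermitian_simps)
  have t: "?g (t v u) (nab v \<nu> u) = ?g (t v u) (t v u)" for v
    using T(2)[OF u, of v "T v u"] fubini_study_commute unfolding t_def[symmetric]
    by (simp add: fubini_study_simps fubini_study_commute[of "f u" "nab v \<nu> u"])
  have tJ: "?g (nab w (t v) u) (\<i> *s \<nu> u) = Re (\<i> * ?G (t v u) (nab w \<nu> u))" for v w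
    using move[OF diff_t, of v w] perp'
    by (simp add: fubini_study_eq_Re fs_hermitian_simps t_def)
  \<comment> \<open>\<open>shape_J\<close> absorbs the factor \<open>\<i>\<close> here by trading
    \<open>x\<close> for \<open>y\<close>. In the companion equation it supplies a second
    \<open>\<i>\<close>, whence the minus sign; both squares then enter \<open>ricci\<close> with
    the sign of the curvature term.\<close>
  have "?g (nab x (t y) u) (\<i> *s \<nu> u) = ?g (t y u) (t y u)"
    unfolding tJ t[symmetric] by (simp only: t_def shape_J fubini_study_eq_Re)
  moreover have "?g (nab y (t x) u) (\<i> *s \<nu> u) = - ?g (t x u) (t x u)"
    unfolding tJ t[symmetric] by (simp add: t_def shape_J fubini_study_eq_Re)
  moreover have nonneg: "?g v v \<ge> 0" for v
    using fubini_study_pos[of v "f u"] by (cases "v = 0") (simp_all add: fubini_study_simps)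
  ultimately have "?g (d x u) (d x u) * ?g (\<nu> u) (\<nu> u) \<le> 0"
    using ricci curv nonneg[of "t x u"] nonneg[of "t y u"] by linarith
  then have "\<not> (0 < ?g (d x u) (d x u) \<and> 0 < ?g (\<nu> u) (\<nu> u))"
    using mult_pos_pos by fastforce
  then show ?thesis using fubini_study_pos d_eq_0_iff[OF u] by metis
qed

end

section \<open>A smooth field that is normal together with its image under \<open>J\<close>\<close>

lemma exists_not_in_complex_span:
  fixes p q :: "complex^'n::finite"
  assumes "CARD('n) > 2"
  obtains v where "\<And>\<alpha> \<beta>. v \<noteq> \<alpha> *s p + \<beta> *s q"
proof -
  let ?S = "{p, \<i> *s p, q, \<i> *s q}"
  have "dim (span ?S) \<le> card ?S" unfolding dim_span by (rule dim_le_card') simp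
  also have "card ?S \<le> 4" by (simp add: card_insert_if)
  \<comment> \<open>The real dimension is twice \<open>CARD('n)\<close>, hence at least 6.\<close>
  also have "4 < DIM(complex^'n)" using assms by simp
  finally have "span ?S \<noteq> UNIV" by (metis dim_UNIV less_irrefl)
  then obtain v where v: "v \<notin> span ?S" by blast
  have "\<alpha> *s p + \<beta> *s q \<in> span ?S" for \<alpha> \<beta>
  proof -
    have mult: "\<gamma> *s w = Re \<gamma> *\<^sub>R w + Im \<gamma> *\<^sub>R (\<i> *s w)" for \<gamma> and w :: "complex^'n"
      by (simp add: vec_eq_iff complex_eq_iff algebra_simps)
    show ?thesis
      unfolding mult[of \<alpha> p] mult[of \<beta> q] by (intro span_add span_scale) (auto intro: span_base)
  qed
  with v that show thesis by metis
qed

context projective_immersion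
begin

text \<open>The tangent space contains the complex line of \<open>d x u\<close> and has one further
  real direction \<open>d z u\<close>, so over the complex numbers these two vectors
  suffice.\<close>

lemma CR_frame:
  assumes u: "u \<in> W" and DIM: "DIM('e) = 3" and "holomorphic_tangent_space f u \<noteq> {0}"
  obtains x y z where "d y u = \<i> *s d x u" "x \<noteq> 0" "z \<notin> span {x, y}"
    "\<And>v. \<exists>\<alpha> \<beta>. d v u = \<alpha> *s d x u + \<beta> *s d z u"
proof -
  have "0 \<in> holomorphic_tangent_space f u"
    using d_simps(4)[OF u] by (auto simp: holomorphic_tangent_space_def complex_structure_def tangent_space_def
        intro!: image_eqI[of _ _ 0])
  then obtain h where "h \<in> holomorphic_tangent_space f u" "h \<noteq> 0" using assms(3) by blast
  then obtain x y where "h = d y u" "h = \<i> *s d x u"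
    by (auto simp: holomorphic_tangent_space_def complex_structure_def tangent_space_def)
  with \<open>h \<noteq> 0\<close> have xy: "d y u = \<i> *s d x u" and "d y u \<noteq> 0" by simp_all
  then have x: "x \<noteq> 0" using d_simps(4)[OF u] by auto
  \<comment> \<open>If \<open>y\<close> were a real multiple of \<open>x\<close>, then
    \<open>\<i>\<close> would be real.\<close>
  have xy_ne: "y \<notin> span {x}"
  proof
    assume "y \<in> span {x}"
    then obtain r where "y = r *\<^sub>R x" by (auto simp: span_singleton)
    then have "(of_real r - \<i>) *s d x u = 0"
      using xy d_simps(3)[OF u, of r x] by (simp add: scaleR_eq_vector_scalar_mult vec_eq_iff algebra_simps)
    then have "d x u = 0 \<or> of_real r = \<i>" by (auto simp: vec_eq_iff)
    then show False using x d_eq_0_iff[OF u] by (auto simp: complex_eq_iff)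
  qed
  have "dim (span {x, y}) \<le> card {x, y}" unfolding dim_span by (rule dim_le_card') simp
  also have "\<dots> \<le> 2" by (simp add: card_insert_if)
  finally have "span {x, y} \<noteq> UNIV" using DIM by (metis dim_UNIV numeral_le_iff semiring_norm(72) not_less_eq_eq eval_nat_numeral(3) le_refl)
  then obtain z where z: "z \<notin> span {x, y}" by blast
  have xyz: "z \<noteq> x" "z \<noteq> y" "y \<noteq> x" using z xy_ne by (auto intro: span_base)
  have "independent {z, y, x}"
    using z[unfolded insert_commute[of x y]] xy_ne x xyz by (simp add: independent_insert)
  then have "UNIV \<subseteq> span {z, y, x}"
    by (intro card_ge_dim_independent) (use DIM xyz in auto)
  then have "\<exists>\<alpha> \<beta>. d v u = \<alpha> *s d x u + \<beta> *s d z u" for v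
  proof -
    have "v \<in> span {z, y, x}" using \<open>UNIV \<subseteq> _\<close> by blast
    then obtain k l m where "v = k *\<^sub>R z + l *\<^sub>R y + m *\<^sub>R x"
      by (auto simp: span_insert span_singleton algebra_simps)
    then have "d v u = (of_real m + \<i> * of_real l) *s d x u + of_real k *s d z u"
      by (simp add: d_simps[OF u] xy scaleR_eq_vector_scalar_mult vec_eq_iff algebra_simps)
    then show ?thesis by blast
  qed
  with xy x z that show thesis by blast
qed

text \<open>
  Gram-Schmidt without divisions: where the two directions become dependent over the complex
  numbers, this field is smooth and vanishes.
\<close>

definition complex_normal_field :: "'e \<Rightarrow> 'e \<Rightarrow> complex^'n \<Rightarrow> 'e \<Rightarrow> complex^'n" where
  "complex_normal_field a c v u = (let
     G = fs_hermitian (f u); e = d a u;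
     e' = G e e *s d c u - G (d c u) e *s e
   in (G e e * G e' e') *s v - (G e' e' * G v e) *s e - (G e e * G v e') *s e')"

lemma smooth_complex_normal_field: "smooth_on W (complex_normal_field a c v)"
  unfolding complex_normal_field_def[abs_def] Let_def
  by (intro smooth_on_diff smooth_on_scale smooth_on_mult smooth_on_fs_hermitian smooth_on_const
      open_W smooth_f smooth_d)

text \<open>If \<open>e'\<close> vanishes, so does the field. Otherwise \<open>d a u\<close> and
  \<open>d c u\<close> are independent over the complex numbers and, by the rank bound, their
  complex span contains the tangent space.\<close>

lemma complex_normal_field_perp:
  assumes u: "u \<in> W" and a: "a \<noteq> 0"
    and rank: "\<And>v. \<exists>\<alpha> \<beta>. d v u = \<alpha> *s p + \<beta> *s q"
  shows "fs_hermitian (f u) (complex_normal_field a c v u) (d w u) = 0"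
proof -
  define G where "G = fs_hermitian (f u)"
  define e where "e = d a u"
  define e' where "e' = G e e *s d c u - G (d c u) e *s e"
  define \<nu> where "\<nu> = complex_normal_field a c v u"
  note G = fs_hermitian_simps[of "f u", folded G_def]
  have \<nu>: "\<nu> = (G e e * G e' e') *s v - (G e' e' * G v e) *s e - (G e e * G v e') *s e'"
    by (simp add: \<nu>_def complex_normal_field_def Let_def G_def e_def e'_def)
  have A: "G e e \<noteq> 0" "cnj (G e e) = G e e"
    using d_eq_0_iff[OF u] a cnj_fs_hermitian by (simp_all add: G_def e_def)
  have e'e: "G e' e = 0" by (simp add: e'_def G)
  have ee': "G e e' = 0"
    using e'e cnj_fs_hermitian[of "f u" e' e] by (simp add: G_def)
  have \<nu>e: "G \<nu> e = 0" by (simp add: \<nu> G e'e)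
  have "G \<nu> e' = 0" by (simp add: \<nu> G ee')
  then have \<nu>c: "G \<nu> (d c u) = 0" using A \<nu>e by (simp add: e'_def G)
  have "G \<nu> (d w u) = 0"
  proof (cases "e' = 0")
    case True
    then show ?thesis by (simp add: \<nu> G_def)
  next
    case False
    obtain \<alpha> \<beta> where ab: "e = \<alpha> *s p + \<beta> *s q" using rank unfolding e_def by blast
    obtain \<gamma> \<delta> where cd: "d c u = \<gamma> *s p + \<delta> *s q" using rank by blast
    \<comment> \<open>A zero determinant would make \<open>d c u\<close> a complex multiple of
      \<open>e\<close>, and then \<open>e'\<close> would vanish.\<close>
    have det: "\<alpha> * \<delta> - \<beta> * \<gamma> \<noteq> 0"
    proof
      assume "\<alpha> * \<delta> - \<beta> * \<gamma> = 0"
      then have "\<delta> *s e = \<beta> *s d c u" "\<gamma> *s e = \<alpha> *s d c u"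
        unfolding ab cd by (simp_all add: vec_eq_iff algebra_simps)
      moreover have "\<alpha> \<noteq> 0 \<or> \<beta> \<noteq> 0" using ab A(1) by (auto simp: G_def)
      ultimately have "\<exists>k. d c u = k *s e"
        by (metis (no_types, lifting) vector_smult_assoc vector_smult_lid left_inverse)
      then obtain k where "d c u = k *s e" ..
      then show False using False by (simp add: e'_def G mult.commute)
    qed
    have 1: "cnj \<alpha> * G \<nu> p + cnj \<beta> * G \<nu> q = 0" using \<nu>e unfolding ab by (simp add: G)
    have 2: "cnj \<gamma> * G \<nu> p + cnj \<delta> * G \<nu> q = 0" using \<nu>c unfolding cd by (simp add: G)
    \<comment> \<open>Cramer's rule for the equations \<open>1\<close> and \<open>2\<close>; the
      coefficients are conjugated because they come out of the second slot.\<close>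
    have "cnj (\<alpha> * \<delta> - \<beta> * \<gamma>) * G \<nu> p
        = cnj \<delta> * (cnj \<alpha> * G \<nu> p + cnj \<beta> * G \<nu> q) - cnj \<beta> * (cnj \<gamma> * G \<nu> p + cnj \<delta> * G \<nu> q)"
      by (simp add: algebra_simps)
    moreover have "cnj (\<alpha> * \<delta> - \<beta> * \<gamma>) * G \<nu> q
        = cnj \<alpha> * (cnj \<gamma> * G \<nu> p + cnj \<delta> * G \<nu> q) - cnj \<gamma> * (cnj \<alpha> * G \<nu> p + cnj \<beta> * G \<nu> q)"
      by (simp add: algebra_simps)
    moreover have "cnj (\<alpha> * \<delta> - \<beta> * \<gamma>) \<noteq> 0" using det by (metis complex_cnj_zero_iff)
    ultimately have "G \<nu> p = 0" "G \<nu> q = 0" unfolding 1 2 by simp_all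
    moreover obtain \<zeta> \<eta> where "d w u = \<zeta> *s p + \<eta> *s q" using rank by blast
    ultimately show ?thesis by (simp add: G)
  qed
  then show ?thesis by (simp add: G_def \<nu>_def)
qed

text \<open>Under these conditions both squared lengths are nonzero, so a zero of the field could be
  solved for \<open>v\<close> as a combination of \<open>d a u\<close> and
  \<open>d c u\<close>.\<close>

lemma complex_normal_field_nonzero:
  assumes "d a u \<noteq> 0" "\<And>k. d c u \<noteq> k *s d a u" "\<And>\<alpha> \<beta>. v \<noteq> \<alpha> *s d a u + \<beta> *s d c u"
  shows "complex_normal_field a c v u \<noteq> 0"
proof
  define G where "G = fs_hermitian (f u)"
  define e where "e = d a u"
  define e' where "e' = G e e *s d c u - G (d c u) e *s e"
  define A where "A = G e e"
  define B where "B = G e' e'"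
  have A: "A \<noteq> 0" using assms(1) by (simp add: A_def G_def e_def)
  have "e' \<noteq> 0"
  proof
    assume "e' = 0"
    then have "d c u = (G (d c u) e / A) *s e"
      using A by (simp add: e'_def A_def[symmetric] vec_eq_iff field_simps)
    then show False using assms(2) by (simp add: e_def)
  qed
  then have B: "B \<noteq> 0" by (simp add: B_def G_def)
  have "complex_normal_field a c v u = (A * B) *s v - (B * G v e) *s e - (A * G v e') *s e'"
    by (simp only: complex_normal_field_def Let_def G_def e_def e'_def A_def B_def)
  moreover assume "complex_normal_field a c v u = 0"
  ultimately have "(A * B) *s v = (B * G v e) *s e + (A * G v e') *s e'"
    by (simp add: algebra_simps)
  then have "v = (G v e / A) *s e + (G v e' / B) *s e'"
    using A B by (simp add: vec_eq_iff field_simps)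
  then have "v = (G v e / A - G v e' / B * G (d c u) e) *s d a u + (G v e' / B * A) *s d c u"
    by (subst (asm) (2) e'_def) (simp add: A_def e_def[symmetric] vec_eq_iff algebra_simps)
  then show False using assms(3) by blast
qed

text \<open>\<open>x\<close> and \<open>y\<close> are extended as constant coordinate fields: the
  relation between \<open>d y\<close> and \<open>d x\<close> is needed at \<open>u\<close> alone,
  but orthogonality of \<nu> on all of \<open>W\<close>.\<close>

lemma normal_connection_not_flat:
  assumes "u \<in> W" and DIM: "DIM('e) = 3" "CARD('n) > 2"
    and H: "\<And>u. u \<in> W \<Longrightarrow> holomorphic_tangent_space f u \<noteq> {0}"
  obtains X Y \<nu> where "smooth_on W X" "smooth_on W Y" "smooth_on W \<nu>"
    "\<And>u. u \<in> W \<Longrightarrow> \<nu> u \<in> normal_space fubini_study f u"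
    "normal_curvature fubini_study f X Y \<nu> u \<noteq> 0"
proof -
  note u = \<open>u \<in> W\<close>
  obtain x y z where xyz: "d y u = \<i> *s d x u" "x \<noteq> 0" "z \<notin> span {x, y}"
    using CR_frame[OF u DIM(1) H[OF u]] by metis
  obtain v where v: "\<And>\<alpha> \<beta>. v \<noteq> \<alpha> *s d x u + \<beta> *s d z u"
    using exists_not_in_complex_span[OF DIM(2)] by blast
  define \<nu> where "\<nu> = complex_normal_field x z v"
  have smooth: "smooth_on W \<nu>" unfolding \<nu>_def by (rule smooth_complex_normal_field)
  have perp: "fs_hermitian (f w) (\<nu> w) (d c w) = 0" if w: "w \<in> W" for w c
  proof -
    \<comment> \<open>Away from \<open>u\<close> the vector \<open>d x w\<close> need not be
      holomorphic, so the spanning pair is taken afresh from the CR condition at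
      \<open>w\<close>.\<close>
    obtain p q where "\<And>v. \<exists>\<alpha> \<beta>. d v w = \<alpha> *s p + \<beta> *s q"
      using CR_frame[OF w DIM(1) H[OF w]] by metis
    then show ?thesis unfolding \<nu>_def by (rule complex_normal_field_perp[OF w xyz(2)])
  qed
  have "d z u \<noteq> k *s d x u" for k
  proof
    assume "d z u = k *s d x u"
    also have "\<dots> = d (Re k *\<^sub>R x + Im k *\<^sub>R y) u"
      by (simp add: d_simps u xyz(1) vec_eq_iff complex_eq_iff algebra_simps)
    finally have "z = Re k *\<^sub>R x + Im k *\<^sub>R y" using d_inject[OF u] by blast
    also have "\<dots> \<in> span {x, y}" by (intro span_add span_scale span_base) auto
    finally show False using xyz(3) by simp
  qed
  then have "\<nu> u \<noteq> 0"
    unfolding \<nu>_def using d_eq_0_iff[OF u] xyz(2) v by (intro complex_normal_field_nonzero) auto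
  then have "normal_curvature fubini_study f (\<lambda>_. x) (\<lambda>_. y) \<nu> u \<noteq> 0"
    using normal_curvature_nonzero[OF u xyz(1) smooth perp] xyz(2) by blast
  moreover have "\<nu> w \<in> normal_space fubini_study f w" if "w \<in> W" for w
    using perp[OF that] by (auto simp: normal_space_def tangent_space_def fubini_study_eq_Re)
  ultimately show thesis using that smooth smooth_on_const by blast
qed

end

section \<open>Three-dimensional CR submanifolds\<close>

text \<open>Only openness of \<open>W\<close> needs an argument: the preimage of \<open>V\<close> is
  open, and the chart is a homeomorphism onto an open set.\<close>

lemma projective_immersion_coordinate_expression:
  assumes "immersed_3_submanifold X A F" "(W, f) \<in> coordinate_expressions A complex_projective_atlas F"
  shows "projective_immersion W f"
proof
  have sm: "smooth_manifold X A" and im: "smooth_immersion X A complex_projective_atlas F"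
    using assms(1) by (simp_all add: immersed_3_submanifold_def)
  show "smooth_on W f" "\<And>u. u \<in> W \<Longrightarrow> inj (frechet_derivative f (at u))"
    using im assms(2) unfolding smooth_immersion_def by blast+
  obtain U \<phi> V \<psi> where W: "W = \<phi> ` {x \<in> U. F x \<in> V}" and U: "(U, \<phi>) \<in> A"
    and V: "(V, \<psi>) \<in> complex_projective_atlas"
    using assms(2) unfolding coordinate_expressions_def by blast
  have U': "openin X U" "open (\<phi> ` U)" "homeomorphic_map (subtopology X U) (top_of_set (\<phi> ` U)) \<phi>"
    using sm U unfolding smooth_manifold_def by blast+
  have "openin X {x \<in> topspace X. F x \<in> V}"
    using im V unfolding smooth_immersion_def by blast
  then have "openin X (U \<inter> {x \<in> topspace X. F x \<in> V})" using U'(1) by blast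
  moreover have "U \<inter> {x \<in> topspace X. F x \<in> V} = {x \<in> U. F x \<in> V}"
    using openin_subset[OF U'(1)] by blast
  ultimately have "openin (subtopology X U) {x \<in> U. F x \<in> V}"
    by (metis (no_types, lifting) openin_open_subtopology[OF U'(1)] mem_Collect_eq subsetI)
  then have "openin (top_of_set (\<phi> ` U)) W"
    unfolding W using homeomorphic_imp_open_map[OF U'(3)] by (simp add: open_map_def)
  then show "open W" using U'(2) openin_open_trans by blast
qed

lemma coordinate_expression_at_point:
  assumes "immersed_3_submanifold X A F"
  obtains W f u where "(W, f) \<in> coordinate_expressions A complex_projective_atlas F" "u \<in> W"
proof -
  obtain x where x: "x \<in> topspace X" using assms unfolding immersed_3_submanifold_def by blast
  have "(\<Union>(U, \<phi>)\<in>A. U) = topspace X" "F ` topspace X \<subseteq> (\<Union>(V, \<psi>)\<in>complex_projective_atlas. V)"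
    using assms by (simp_all add: immersed_3_submanifold_def smooth_manifold_def smooth_immersion_def)
  then obtain U \<phi> V \<psi> where "(U, \<phi>) \<in> A" "x \<in> U" "(V, \<psi>) \<in> complex_projective_atlas" "F x \<in> V"
    using x by blast
  then show thesis
    by (intro that[of "\<phi> ` {x \<in> U. F x \<in> V}" "\<psi> \<circ> F \<circ> inv_into U \<phi>" "\<phi> x"])
       (auto simp: coordinate_expressions_def)
qed

theorem corollary1p5:
  fixes p :: nat
  assumes "p > 1" and "real CARD('n::finite) = (3 + real p) / 2"
  shows "\<not> (\<exists>(X :: 'm topology) (A :: ('m, real^3) chart set)
              (F :: 'm \<Rightarrow> (complex^('n option)) set).
            immersed_3_submanifold X A F \<and>
            CR_submanifold_of_maximal_CR_dimension A F \<and>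
            minimal_submanifold A F \<and>
            flat_normal_connection A F)"
proof
  assume "\<exists>(X :: 'm topology) (A :: ('m, real^3) chart set)
              (F :: 'm \<Rightarrow> (complex^('n option)) set).
            immersed_3_submanifold X A F \<and>
            CR_submanifold_of_maximal_CR_dimension A F \<and>
            minimal_submanifold A F \<and>
            flat_normal_connection A F"
  then obtain X :: "'m topology" and A :: "('m, real^3) chart set" and F :: "'m \<Rightarrow> (complex^('n option)) set"
    where M: "immersed_3_submanifold X A F" and CR: "CR_submanifold_of_maximal_CR_dimension A F"
      and flat: "flat_normal_connection A F"
    by blast
  obtain W f u where Wf: "(W, f) \<in> coordinate_expressions A complex_projective_atlas F" and u: "u \<in> W"
    using coordinate_expression_at_point[OF M] .
  interpret projective_immersion W f by (rule projective_immersion_coordinate_expression[OF M Wf])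
  \<comment> \<open>This is where \<open>p > 1\<close> enters: it leaves room beyond the complex
    rank two of the tangent space.\<close>
  have "real CARD('n) > 2" using assms by simp
  then have n: "CARD('n) > 2" by simp
  have H: "holomorphic_tangent_space f w \<noteq> {0}" if "w \<in> W" for w
  proof
    assume "holomorphic_tangent_space f w = {0}"
    moreover have "dim (holomorphic_tangent_space f w) = 2"
      using CR Wf that unfolding CR_submanifold_of_maximal_CR_dimension_def by blast
    ultimately show False by simp
  qed
  obtain Y Z \<nu> where "smooth_on W Y" "smooth_on W Z" "smooth_on W \<nu>"
    "\<And>u. u \<in> W \<Longrightarrow> \<nu> u \<in> normal_space fubini_study f u"
    "normal_curvature fubini_study f Y Z \<nu> u \<noteq> 0"
    using normal_connection_not_flat[OF u _ n H] by auto
  then show False using flat Wf u unfolding flat_normal_connection_def by blast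
qed

end
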